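(* Let $k_1\ge k_2\ge 0$ be integers. The minimum number of crossings of a doubly-anchored open semi-meander in the stratum $\mathcal{Q}(k_1,k_2,-1^{k_1+k_2+4})$ is $k_1+k_2+2$.
   Context: An open semi-meander is a planar configuration consisting of an infinite horizontal ray and a simple arc intersecting the ray transversally, where the arc is allowed to pass around the endpoint of the ray; crossings are the intersection points of the arc with the ray. In a doubly-anchored open semi-meander both the ray and the intersecting arc are anchored, i.e. both are regarded as compact arcs on the sphere whose endpoints (the anchors) are punctures: the intersecting arc is a compact simple arc with endpoints off the ray, and the ray is replaced by a compact initial horizontal segment of it containing all crossings in its interior. Stratum of an anchored meander. View the configuration as a graph on the sphere whose vertices are the crossings (valence four) and the anchors (valence one). Each complementary region is treated as a polygon whose sides are the edges on its boundary, where an edge incident to a valence-one vertex is counted as a single side. A region that is a $(2k+4)$-gon is assigned order $k$ (bigons: $-1$, 4-gons: $0$, hexagons: $1$, ...). In addition each valence-one vertex contributes an order $-1$. The anchored semi-meander lies in $\mathcal{Q}(k_1,\dots,k_n,-1^{p})$ (where $-1^p$ means $-1$ repeated $p$ times) if the resulting multiset of orders is $\{k_1,\dots,k_n,-1,\dots,-1\}$ ($p$ copies of $-1$), where additional regions of order $0$ beyond those listed are ignored; an order $0$ appearing in the list must be realised by a distinct 4-gon for each occurrence. *)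

theory Defs
  imports "HOL-Analysis.Analysis" "HOL-Library.Multiset"
begin

text \<open>The horizontal ray is normalised to start at the origin and to point in the positive real
  direction of the complex plane.\<close>

definition ray :: "complex set" where
  "ray = {z. Im z = 0 \<and> 0 \<le> Re z}"

text \<open>Arcs are merely continuous, so transversality is topological: at time \<open>t\<close> the arc passes
  strictly from one side of the real line to the other. This is only used at points of the ray other
  than its endpoint, near which the sides of the ray are given by the sign of the imaginary part.\<close>

definition crosses_transversally :: "(real \<Rightarrow> complex) \<Rightarrow> real \<Rightarrow> bool" where
  "crosses_transversally g t \<longleftrightarrow>
     (\<forall>\<^sub>F s in at_left t. Im (g s) < 0) \<and> (\<forall>\<^sub>F s in at_right t. Im (g s) > 0) \<or>
     (\<forall>\<^sub>F s in at_left t. Im (g s) > 0) \<and> (\<forall>\<^sub>F s in at_right t. Im (g s) < 0)"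

definition open_semi_meander :: "(real \<Rightarrow> complex) \<Rightarrow> bool" where
  "open_semi_meander g \<longleftrightarrow>
     arc g \<and> pathstart g \<notin> ray \<and> pathfinish g \<notin> ray \<and> 0 \<notin> path_image g \<and>
     (\<forall>t\<in>{0<..<1}. g t \<in> ray \<longrightarrow> crosses_transversally g t)"

text \<open>Always finite for an open semi-meander: transversal crossing times are isolated, and they form
  a compact set.\<close>

definition crossings :: "(real \<Rightarrow> complex) \<Rightarrow> complex set" where
  "crossings g = path_image g \<inter> ray"

text \<open>The ray is cut off at the real number \<open>L\<close>, beyond all crossings.\<close>

definition doubly_anchored_open_semi_meander :: "(real \<Rightarrow> complex) \<Rightarrow> real \<Rightarrow> bool" where
  "doubly_anchored_open_semi_meander g L \<longleftrightarrow>
     open_semi_meander g \<and> 0 < L \<and> crossings g \<subseteq> open_segment 0 (complex_of_real L)"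

definition meander_graph :: "(real \<Rightarrow> complex) \<Rightarrow> real \<Rightarrow> complex set" where
  "meander_graph g L = closed_segment 0 (complex_of_real L) \<union> path_image g"

text \<open>The four anchors are exactly the vertices of valence one.\<close>

definition anchors :: "(real \<Rightarrow> complex) \<Rightarrow> real \<Rightarrow> complex set" where
  "anchors g L = {0, complex_of_real L, pathstart g, pathfinish g}"

text \<open>Edges are taken without their end vertices.\<close>

definition edges :: "(real \<Rightarrow> complex) \<Rightarrow> real \<Rightarrow> complex set set" where
  "edges g L = components (meander_graph g L - (crossings g \<union> anchors g L))"

text \<open>The graph is a compact subset of the plane, so its complementary regions on the sphere are the
  components of its complement in the plane, the point at infinity being added to the unbounded one.
  This changes neither the number of regions nor the edges on their boundaries.\<close>

definition regions :: "(real \<Rightarrow> complex) \<Rightarrow> real \<Rightarrow> complex set set" where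
  "regions g L = components (- meander_graph g L)"

text \<open>The two sides of an edge can belong to the same region only if the edge is incident to an anchor
  (removing any other edge leaves the graph connected), and such an edge counts as a single side.
  Hence every edge on the boundary counts exactly once.\<close>

definition num_sides :: "(real \<Rightarrow> complex) \<Rightarrow> real \<Rightarrow> complex set \<Rightarrow> nat" where
  "num_sides g L R = card {e \<in> edges g L. e \<subseteq> frontier R}"

text \<open>The number of sides is always even, because sides on the segment and sides on the arc alternate
  along the boundary of a region.\<close>

definition region_order :: "(real \<Rightarrow> complex) \<Rightarrow> real \<Rightarrow> complex set \<Rightarrow> int" where
  "region_order g L R = (THE k. int (num_sides g L R) = 2 * k + 4)"

definition orders :: "(real \<Rightarrow> complex) \<Rightarrow> real \<Rightarrow> int multiset" where
  "orders g L =
     image_mset (region_order g L) (mset_set (regions g L)) +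
     image_mset (\<lambda>v. - 1) (mset_set (anchors g L))"

text \<open>The \<open>z\<close> additional zeros are the 4-gons beyond those listed in \<open>K\<close>.\<close>

definition in_stratum :: "(real \<Rightarrow> complex) \<Rightarrow> real \<Rightarrow> int multiset \<Rightarrow> bool" where
  "in_stratum g L K \<longleftrightarrow> (\<exists>z. orders g L = K + replicate_mset z 0)"

end

theory Submission
  imports Defs
begin

text \<open>
  Lower bound: the multiset of orders has one entry per region and one per anchor, so membership in
  the stratum forces at least \<open>k1 + k2 + 2\<close> regions. Drawing the arc from one crossing to the next
  adds at most one region per crossing after the first, by the Jordan curve theorem and Janiszewski's
  theorem, so there are at most as many regions as crossings.

  Sharpness: let \<open>n = k1 + k2 + 2\<close> and \<open>m = k1 + 1\<close>, and let the arc be \<open>r \<mapsto> r cis (\<theta> r)\<close> for \<open>r\<close> from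
  \<open>1/2\<close> to \<open>n + 1/2\<close>. It crosses the ray exactly at \<open>1, \<dots>, n\<close>; in the annulus \<open>m < |z| < m + 1\<close> it winds
  once around the origin, and in every other annulus \<open>j < |z| < j + 1\<close> it makes a small excursion to
  one side of the ray. The excursions between consecutive crossings cut off \<open>k1 + k2\<close> bigons. The
  remaining inner region has the two edges of each annulus \<open>0, \<dots>, m\<close> as sides, and the outer region
  those of the annuli \<open>m, \<dots>, n\<close>. These are \<open>n\<close> disjoint open sets covering the complement of the graph,
  so the upper bound on the number of regions already shows that they are its components.
\<close>

section \<open>The number of regions\<close>

text \<open>A component of the complement of \<open>Y \<union> J\<close> is determined by the components of \<open>- Y\<close> and \<open>- J\<close> that
  contain it (Janiszewski). Since \<open>J - Y\<close> is connected, \<open>J\<close> meets only one component of \<open>- Y\<close>, so every other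
  one lies in a single component of \<open>- J\<close>.\<close>

lemma components_Compl_Un_le:
  fixes Y J :: "complex set"
  assumes Y: "compact Y" and J: "compact J"
    and conn: "connected (Y \<inter> J)" "connected (J - Y)"
    and finY: "finite (components (- Y))" and finJ: "finite (components (- J))"
  shows "finite (components (- (Y \<union> J)))"
    and "card (components (- (Y \<union> J))) + 1 \<le> card (components (- Y)) + card (components (- J))"
proof -
  let ?C = "components (- (Y \<union> J))" and ?A = "components (- Y)" and ?B = "components (- J)"
  have ne: "- K \<noteq> {}" if "compact K" for K :: "complex set"
    using that compact_imp_bounded not_bounded_UNIV by (metis Compl_eq_Diff_UNIV Diff_eq_empty_iff top.extremum_uniqueI)
  have ex: "\<exists>U. U \<in> components (- K) \<and> C \<subseteq> U" if "C \<in> ?C" "K = Y \<or> K = J" for C K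
    using that exists_component_superset[of C "- K"] ne[OF Y] ne[OF J] in_components_subset in_components_connected
    by (metis Compl_Un inf.bounded_iff)
  obtain f where f: "\<And>C. C \<in> ?C \<Longrightarrow> f C \<in> ?A \<and> C \<subseteq> f C"
    using ex[of _ Y] by metis
  obtain h where h: "\<And>C. C \<in> ?C \<Longrightarrow> h C \<in> ?B \<and> C \<subseteq> h C"
    using ex[of _ J] by metis
  have cc: "connected_component S x y" if "U \<in> components S" "x \<in> U" "y \<in> U" for S :: "complex set" and U x y
    using that in_components_connected in_components_subset connected_component_def by metis
  have inj: "inj_on (\<lambda>C. (f C, h C)) ?C"
  proof (rule inj_onI)
    fix C D assume C: "C \<in> ?C" and D: "D \<in> ?C" and eq: "(f C, h C) = (f D, h D)"
    obtain x y where x: "x \<in> C" and y: "y \<in> D"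
      using C D in_components_nonempty by blast
    have "connected_component (- Y) x y"
      by (rule cc[of "f C"]) (use f C D x y eq in auto)
    moreover have "connected_component (- J) x y"
      by (rule cc[of "h C"]) (use h C D x y eq in auto)
    ultimately have "connected_component (- (Y \<union> J)) x y"
      using Janiszewski[OF Y _ conn(1)] compact_imp_closed[OF J] by blast
    then obtain T where T: "connected T" "T \<subseteq> - (Y \<union> J)" "x \<in> T" "y \<in> T"
      unfolding connected_component_def by blast
    show "C = D"
      by (rule joinable_components_eq[of T "- (Y \<union> J)"]) (use T C D x y in blast)
  qed
  obtain U0 where U0: "U0 \<in> ?A" "J - Y \<subseteq> U0"
    using exists_component_superset[OF _ ne[OF Y] conn(2)] by blast
  have "\<exists>V. V \<in> ?B \<and> U \<subseteq> V" if "U \<in> ?A - {U0}" for U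
  proof -
    have "U \<inter> U0 = {}" "U \<subseteq> - Y"
      using that U0 components_nonoverlap[of U "- Y" U0] in_components_subset[of U "- Y"] by auto
    then have "U \<subseteq> - J" using U0 by blast
    then show ?thesis
      using exists_component_superset[OF _ ne[OF J]] that in_components_connected by blast
  qed
  then obtain v where v: "\<And>U. U \<in> ?A - {U0} \<Longrightarrow> v U \<in> ?B \<and> U \<subseteq> v U"
    by metis
  \<comment> \<open>A pair \<open>(f C, h C)\<close> is determined by its first entry unless that
    entry is \<open>U0\<close>, where the second entry is free. This leaves room for
    \<open>card ?A - 1 + card ?B\<close> pairs.\<close>
  let ?P = "(\<lambda>U. (U, v U)) ` (?A - {U0}) \<union> {U0} \<times> ?B"
  have sub: "(\<lambda>C. (f C, h C)) ` ?C \<subseteq> ?P"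
  proof (rule image_subsetI)
    fix C assume C: "C \<in> ?C"
    show "(f C, h C) \<in> ?P"
    proof (cases "f C = U0")
      case True then show ?thesis using h C by auto
    next
      case False
      then have U: "f C \<in> ?A - {U0}" using f C by auto
      obtain x where x: "x \<in> C" using C in_components_nonempty by blast
      have "h C \<inter> v (f C) \<noteq> {}" using x v[OF U] f[OF C] h[OF C] by blast
      then have "h C = v (f C)"
        using components_nonoverlap v[OF U] h[OF C] by blast
      then show ?thesis using U by auto
    qed
  qed
  have finP: "finite ?P" using finY finJ by auto
  show "finite ?C"
    using finite_imageD[OF finite_subset[OF sub finP] inj] .
  have "card ?C \<le> card ?P"
    using card_inj_on_le[OF inj sub finP] .
  also have "\<dots> \<le> card (?A - {U0}) + card ?B"
    by (rule order_trans[OF card_Un_le])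
      (simp add: card_cartesian_product card_image_le finY)
  also have "card (?A - {U0}) + 1 = card ?A"
    using U0 finY by (metis card_Suc_Diff1 Suc_eq_plus1)
  ultimately show "card ?C + 1 \<le> card ?A + card ?B" by linarith
qed

text \<open>An arc does not separate the plane, so in the preceding bound the term for
  \<open>J\<close> is 1 and no region is gained. The arc may touch \<open>Y\<close> only at its
  start, which makes the intersection connected and leaves the rest of the arc in one piece.\<close>

lemma components_Compl_Un_arc:
  fixes Y :: "complex set"
  assumes Y: "compact Y" and g: "arc g" and Yg: "Y \<inter> path_image g \<subseteq> {pathstart g}"
    and fin: "finite (components (- Y))"
  shows "finite (components (- (Y \<union> path_image g)))"
    and "card (components (- (Y \<union> path_image g))) \<le> card (components (- Y))"
proof -
  have J: "components (- path_image g) = {- path_image g}"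
    using connected_arc_complement[OF g] g compact_arc_image[of g] compact_imp_bounded not_bounded_UNIV
    by (metis Compl_UNIV_eq components_eq_sing_iff DIM_complex double_compl order_refl)
  have "connected (Y \<inter> path_image g)"
    using Yg by (metis connected_empty connected_sing subset_singletonD)
  moreover have "connected (path_image g - Y)"
  proof (cases "Y \<inter> path_image g = {}")
    case True
    then show ?thesis using g connected_arc_image[of g] by (simp add: Diff_triv inf_commute)
  next
    case False
    then have g0: "g 0 \<in> Y" using Yg unfolding pathstart_def by auto
    have "g t \<notin> Y" if "0 < t" "t \<le> 1" for t
    proof
      assume "g t \<in> Y"
      then have "g t = g 0" using Yg that unfolding path_image_def pathstart_def by auto
      then have "t = 0" using g that unfolding arc_def by (auto dest: inj_onD)
      then show False using that by simp
    qed
    then have "path_image g - Y = g ` {0<..1}"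
      using g0 unfolding path_image_def by (force simp: less_le)
    moreover have "continuous_on {0<..1} g"
      using g unfolding arc_def path_def by (auto elim: continuous_on_subset)
    ultimately show ?thesis by (simp add: connected_continuous_image)
  qed
  ultimately show "finite (components (- (Y \<union> path_image g)))"
     "card (components (- (Y \<union> path_image g))) \<le> card (components (- Y))"
    using components_Compl_Un_le[OF Y compact_arc_image[OF g]] fin J by simp_all
qed

text \<open>The two contact points form a disconnected set, so the arc alone cannot play the role of
  \<open>J\<close>. Closing it up with the segment inside \<open>Y\<close> gives a Jordan curve that
  meets \<open>Y\<close> in exactly that segment; its complement has two components, whence the one
  extra region.\<close>

lemma components_Compl_Un_chord:
  fixes Y :: "complex set"
  assumes Y: "compact Y" and g: "arc g" and fin: "finite (components (- Y))"
    and Yg: "Y \<inter> path_image g = {pathstart g, pathfinish g}"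
    and seg: "closed_segment (pathstart g) (pathfinish g) \<subseteq> Y"
  shows "finite (components (- (Y \<union> path_image g)))"
    and "card (components (- (Y \<union> path_image g))) \<le> card (components (- Y)) + 1"
proof -
  define p q where "p = pathstart g" and "q = pathfinish g"
  have pq: "p \<noteq> q" using arc_distinct_ends[OF g] by (simp add: p_def q_def)
  define c where "c = g +++ linepath q p"
  have im: "path_image c = path_image g \<union> closed_segment p q"
    unfolding c_def by (simp add: path_image_join q_def closed_segment_commute)
  have "simple_path c"
    unfolding c_def
    by (rule simple_path_join_loop) 
      (use g pq Yg seg in \<open>auto simp: p_def q_def closed_segment_commute\<close>)
  moreover have "pathfinish c = pathstart c" by (simp add: c_def p_def)
  ultimately have Jc: "inside (path_image c) \<noteq> {}" "connected (inside (path_image c))"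
      "outside (path_image c) \<noteq> {}" "connected (outside (path_image c))"
      "open (inside (path_image c))" "open (outside (path_image c))"
      "inside (path_image c) \<inter> outside (path_image c) = {}"
      "inside (path_image c) \<union> outside (path_image c) = - path_image c"
    using Jordan_inside_outside by blast+
  have comp: "components (- path_image c) = {inside (path_image c), outside (path_image c)}"
    by (rule components_open_unique)
      (use Jc in \<open>auto simp: pairwise_insert disjnt_def Int_commute simp del: inside_Int_outside\<close>)
  have "card (components (- path_image c)) \<le> 2"
    unfolding comp by (simp add: card_insert_if)
  moreover have "finite (components (- path_image c))" unfolding comp by simp
  moreover have "Y \<union> path_image c = Y \<union> path_image g"
    using im seg by (auto simp: p_def q_def)
  moreover have "connected (Y \<inter> path_image c)"
  proof -
    have "Y \<inter> path_image c = (Y \<inter> path_image g) \<union> closed_segment p q"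
      using im seg by (auto simp: p_def q_def)
    also have "\<dots> = closed_segment p q"
      unfolding Yg p_def[symmetric] q_def[symmetric] by (simp add: insert_absorb)
    finally have "Y \<inter> path_image c = closed_segment p q" .
    then show ?thesis by simp
  qed
  moreover have "connected (path_image c - Y)"
  proof -
    have "path_image c - Y = path_image g - (Y \<inter> path_image g)"
      using im seg by (auto simp: p_def q_def)
    also have "\<dots> = path_image g - {p, q}"
      unfolding Yg p_def q_def ..
    finally have "path_image c - Y = path_image g - {p, q}" .
    then show ?thesis using g connected_simple_path_endless[of g] arc_imp_simple_path p_def q_def by metis
  qed
  moreover have "compact (path_image c)"
    using \<open>simple_path c\<close> by (simp add: compact_simple_path_image)
  ultimately show "finite (components (- (Y \<union> path_image g)))"
     "card (components (- (Y \<union> path_image g))) \<le> card (components (- Y)) + 1"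
    using components_Compl_Un_le[OF Y, of "path_image c"] fin by fastforce+
qed

section \<open>Recognising the components of a set\<close>

text \<open>Each member of the partition is open and closed in \<open>S\<close>, so a component that
  meets it stays inside it. Openness is relative to \<open>S\<close> because the partition of
  interest is that of the graph into its edges, which are not open in the plane.\<close>

lemma components_eq_open_partition:
  fixes S :: "'a::topological_space set"
  assumes disj: "pairwise disjnt D" and un: "\<Union>D = S"
    and op: "\<And>X. X \<in> D \<Longrightarrow> openin (top_of_set S) X" and conn: "\<And>X. X \<in> D \<Longrightarrow> connected X \<and> X \<noteq> {}"
  shows "components S = D"
proof -
  have sub: "C = X" if C: "C \<in> components S" and X: "X \<in> D" and ne: "C \<inter> X \<noteq> {}" for C X
  proof -
    have XC: "X \<subseteq> C"
      using components_maximal[OF C, of X] conn[OF X] X un ne by auto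
    have "openin (top_of_set S) (\<Union>(D - {X}))"
      by (intro openin_Union) (use op in auto)
    moreover have "\<Union>(D - {X}) = S - X"
    proof -
      have "X' \<inter> X = {}" if "X' \<in> D - {X}" for X'
        using disj X that unfolding pairwise_def disjnt_def by blast
      then show ?thesis using un by blast
    qed
    ultimately have "openin (top_of_set S) (S - X)" by simp
    then obtain T2 where T2: "open T2" "S - X = S \<inter> T2" unfolding openin_open by auto
    obtain T1 where T1: "open T1" "X = S \<inter> T1" using op[OF X] unfolding openin_open by auto
    have CS: "C \<subseteq> S" by (rule in_components_subset[OF C])
    have "T1 \<inter> T2 \<inter> C = {}" "C \<subseteq> T1 \<union> T2"
      using T1(2) T2(2) CS by blast+
    then have "T1 \<inter> C = {} \<or> T2 \<inter> C = {}"
      using connectedD[OF in_components_connected[OF C] T1(1) T2(1)] by simp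
    moreover have "T1 \<inter> C \<noteq> {}" using ne T1(2) by blast
    ultimately have "C \<inter> (S - X) = {}" using T2(2) by blast
    then show ?thesis using XC in_components_subset[OF C] by blast
  qed
  show ?thesis
  proof (intro equalityI subsetI)
    fix C assume C: "C \<in> components S"
    then obtain x where x: "x \<in> C" using in_components_nonempty by blast
    then obtain X where X: "X \<in> D" "x \<in> X" using in_components_subset[OF C] un by blast
    then have "C = X" using sub[OF C X(1)] x by auto
    then show "C \<in> D" using X(1) by simp
  next
    fix X assume X: "X \<in> D"
    obtain x where x: "x \<in> X" using conn[OF X] by auto
    then have "x \<in> S" using X un by auto
    then obtain C where C: "C \<in> components S" "x \<in> C" by (metis Union_components UnionE)
    then have "C = X" using sub[OF C(1) X] x by auto
    then show "X \<in> components S" using C(1) by simp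
  qed
qed

text \<open>Counting takes the place of connectedness of the members. Each component lies in one
  member and each member contains a component, so the map \<open>f\<close> is onto \<open>D\<close>;
  the cardinality bound makes it injective, so a member cannot hold two components.\<close>

lemma components_eq_card_le:
  fixes S :: "'a::topological_space set"
  assumes disj: "pairwise disjnt D" and un: "\<Union>D = S"
    and op: "\<And>X. X \<in> D \<Longrightarrow> open X \<and> X \<noteq> {}"
    and fin: "finite (components S)" and card: "card (components S) \<le> card D"
  shows "components S = D"
proof -
  have pick: "\<exists>X. X \<in> D \<and> C \<subseteq> X" if C: "C \<in> components S" for C
  proof -
    obtain x X where x: "x \<in> C" "x \<in> X" "X \<in> D"
      using C in_components_nonempty in_components_subset un by blast
    have o: "open (\<Union>(D - {X}))" by (intro open_Union) (use op in auto)
    have "X' \<inter> X = {}" if "X' \<in> D - {X}" for X'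
      using disj x that unfolding pairwise_def disjnt_def by blast
    then have d: "X \<inter> \<Union>(D - {X}) \<inter> C = {}" by blast
    have cov: "C \<subseteq> X \<union> \<Union>(D - {X})"
      using un in_components_subset[OF C] by blast
    have "X \<inter> C = {} \<or> \<Union>(D - {X}) \<inter> C = {}"
      using connectedD[OF in_components_connected[OF C] _ o d cov] op[OF x(3)] by simp
    then show ?thesis using x cov by blast
  qed
  then obtain f where f: "\<And>C. C \<in> components S \<Longrightarrow> f C \<in> D \<and> C \<subseteq> f C" by metis
  have eqX: "f C = X" if "C \<in> components S" "X \<in> D" "x \<in> C" "x \<in> X" for C X x
  proof -
    have "f C \<in> D" "x \<in> f C" using f[OF that(1)] that by auto
    then show ?thesis using disj that(2,4) unfolding pairwise_def disjnt_def by blast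
  qed
  have surj: "D \<subseteq> f ` components S"
  proof
    fix X assume X: "X \<in> D"
    obtain x where x: "x \<in> X" using op[OF X] by auto
    then have "x \<in> S" using X un by auto
    then obtain C where C: "C \<in> components S" "x \<in> C" by (metis Union_components UnionE)
    then have "f C = X" using eqX[OF C(1) X C(2) x] by simp
    then show "X \<in> f ` components S" using C(1) by auto
  qed
  then have im: "f ` components S = D" using f by (auto intro!: equalityI)
  then have inj: "inj_on f (components S)"
    using card card_image_le[OF fin, of f] by (intro eq_card_imp_inj_on[OF fin]) simp
  have "f C = C" if C: "C \<in> components S" for C
  proof
    show "f C \<subseteq> C"
    proof
      fix x assume x: "x \<in> f C"
      then have "x \<in> S" using f[OF C] un by auto
      then obtain C' where C': "C' \<in> components S" "x \<in> C'" by (metis Union_components UnionE)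
      have "f C' = f C" using eqX[OF C'(1) _ C'(2) x] f[OF C] by simp
      then have "C' = C" using inj C C'(1) by (auto dest: inj_onD)
      then show "x \<in> C" using C' by simp
    qed
  qed (use f[OF C] in blast)
  then show ?thesis using im by simp
qed

section \<open>Crossing times and the growth of the number of regions\<close>

lemma doubly_anchoredD:
  assumes "doubly_anchored_open_semi_meander g L"
  shows "arc g" "0 < L" "crossings g \<subseteq> open_segment 0 (of_real L)"
    "\<And>t. t \<in> {0..1} \<Longrightarrow> g t \<in> ray \<Longrightarrow> 0 < t \<and> t < 1 \<and> crosses_transversally g t"
  using assms unfolding doubly_anchored_open_semi_meander_def open_semi_meander_def
    pathstart_def pathfinish_def
  by (auto simp: less_le)

text \<open>The crossing times form a closed set, so an accumulation point would itself be a
  crossing time; but transversality makes \<open>Im (g s)\<close> nonzero at all other nearby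
  times.\<close>

lemma finite_crossing_times:
  assumes d: "doubly_anchored_open_semi_meander g L"
  shows "finite {t \<in> {0..1}. g t \<in> ray}"
proof -
  have cl: "closed ray" unfolding ray_def
    by (intro closed_Collect_conj closed_Collect_eq closed_Collect_le continuous_intros)
  have "\<not> t islimpt {t \<in> {0..1}. g t \<in> ray}" if "t \<in> {0..1}" for t
  proof
    assume lim: "t islimpt {t \<in> {0..1}. g t \<in> ray}"
    have "closed {t \<in> {0..1}. g t \<in> ray}"
      using continuous_on_closed_Collect_le continuous_closed_preimage[of "{0..1}" g ray] cl doubly_anchoredD(1)[OF d]
      unfolding arc_def path_def by (simp add: vimage_def Int_def)
    then have t: "t \<in> {t \<in> {0..1}. g t \<in> ray}" using lim closed_limpt by blast
    then have "crosses_transversally g t" using doubly_anchoredD(4)[OF d] by auto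
    then have "\<forall>\<^sub>F s in at t. Im (g s) \<noteq> 0"
      unfolding crosses_transversally_def eventually_at_split
      by (auto elim: eventually_mono)
    then have "\<forall>\<^sub>F s in at t. \<not> (s \<in> {t \<in> {0..1}. g t \<in> ray})"
      by eventually_elim (auto simp: ray_def)
    then show False using lim
      unfolding islimpt_iff_eventually by blast
  qed
  then have "finite ({0..1} \<inter> {t \<in> {0..1}. g t \<in> ray})"
    by (intro finite_not_islimpt_in_compact) auto
  moreover have "{0..1} \<inter> {t \<in> {0..1}. g t \<in> ray} = {t \<in> {0..1}. g t \<in> ray}" by blast
  ultimately show ?thesis by metis
qed

lemma card_crossings:
  assumes d: "doubly_anchored_open_semi_meander g L"
  shows "card (crossings g) = card {t \<in> {0..1}. g t \<in> ray}"
proof -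
  have "crossings g = g ` {t \<in> {0..1}. g t \<in> ray}"
    unfolding crossings_def path_image_def by auto
  moreover have "inj_on g {t \<in> {0..1}. g t \<in> ray}"
    using doubly_anchoredD(1)[OF d] unfolding arc_def by (elim conjE inj_on_subset) blast
  ultimately show ?thesis by (metis card_image)
qed

text \<open>Induction on the number of crossing times up to \<open>s\<close>. The piece between the
  last two crossings is a chord and adds at most one region; the pieces before the first and after
  the last crossing are attached at one point and add none. The \<open>max 1\<close> covers an arc
  that has not reached the ray yet.\<close>

lemma partial_graph_components:
  assumes d: "doubly_anchored_open_semi_meander g L" and s: "0 < s" "s \<le> 1"
  defines "T \<equiv> {t \<in> {0..1}. g t \<in> ray}"
    and "Y \<equiv> \<lambda>s. closed_segment 0 (complex_of_real L) \<union> g ` {0..s}"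
  shows "finite (components (- Y s)) \<and> card (components (- Y s)) \<le> max 1 (card (T \<inter> {0..s}))"
proof -
  let ?S = "closed_segment 0 (complex_of_real L)"
  note g = doubly_anchoredD(1)[OF d] and L = doubly_anchoredD(2)[OF d]
  have contg: "continuous_on {0..1} g" and inj: "inj_on g {0..1}"
    using g unfolding arc_def path_def by auto
  have injD: "u = v" if "g u = g v" "u \<in> {0..1}" "v \<in> {0..1}" for u v
    using inj_onD[OF inj that] .
  have finT: "finite T" unfolding T_def by (rule finite_crossing_times[OF d])
  have T01: "0 < t \<and> t < 1" if "t \<in> T" for t
    using doubly_anchoredD(4)[OF d, of t] that unfolding T_def by simp
  have Sray: "?S \<subseteq> ray"
    using L unfolding ray_def by (auto simp: closed_segment_def scaleR_conv_of_real)
  have TS: "g t \<in> ?S \<longleftrightarrow> t \<in> T" if "t \<in> {0..1}" for t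
  proof
    show "g t \<in> ?S \<Longrightarrow> t \<in> T" using that Sray unfolding T_def by blast
    assume "t \<in> T"
    then have "g t \<in> crossings g"
      unfolding T_def crossings_def path_image_def by blast
    then have "g t \<in> open_segment 0 (complex_of_real L)" using doubly_anchoredD(3)[OF d] by blast
    then show "g t \<in> ?S" by (rule subsetD[OF segment_open_subset_closed])
  qed
  have arcS: "arc (linepath 0 (complex_of_real L))" using L by simp
  have "components (- ?S) = {- ?S}"
  proof -
    have "connected (- ?S)" using connected_arc_complement[OF arcS] by simp
    moreover have "- ?S \<noteq> {}"
      using compact_imp_bounded[OF compact_segment] not_bounded_UNIV
      by (metis Compl_UNIV_eq double_compl)
    ultimately show ?thesis by (simp add: components_eq_sing_iff)
  qed
  then have S1: "finite (components (- ?S))" "card (components (- ?S)) = 1" by simp_all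
  have compactY: "compact (Y s)" if "s \<le> 1" for s
    unfolding Y_def
    by (intro compact_Un compact_segment compact_continuous_image continuous_on_subset[OF contg] compact_Icc)
      (use that in auto)
  have sub: "arc (subpath u v g)" if "u \<in> {0..1}" "v \<in> {0..1}" "u \<noteq> v" for u v
    using arc_subpath_arc[OF g] that by blast
  show ?thesis using s
  proof (induction "card (T \<inter> {0..s})" arbitrary: s)
    case 0
    then have e: "T \<inter> {0..s} = {}" using finT by simp
    have im: "path_image (subpath 0 s g) = g ` {0..s}"
      using 0 by (simp add: path_image_subpath)
    have "?S \<inter> g ` {0..s} = {}"
    proof -
      have "g t \<notin> ?S" if "t \<in> {0..s}" for t
        using TS[of t] e that 0 by auto
      then show ?thesis by blast
    qed
    then have "?S \<inter> path_image (subpath 0 s g) \<subseteq> {pathstart (subpath 0 s g)}"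
      unfolding im by simp
    then show ?case
      using components_Compl_Un_arc[OF compact_segment sub[of 0 s] _ S1(1)] 0 S1(2) unfolding im Y_def by simp
  next
    case (Suc n)
    have finTs: "finite (T \<inter> {0..s})" using finT by simp
    have ne: "T \<inter> {0..s} \<noteq> {}" using Suc(2) by auto
    define t where "t = Max (T \<inter> {0..s})"
    have "t \<in> T \<inter> {0..s}" unfolding t_def by (rule Max_in[OF finTs ne])
    then have t: "t \<in> T" "0 < t" "t \<le> s" "t < 1" using T01 by auto
    have tmax: "u \<le> t" if "u \<in> T" "u \<le> s" for u
      unfolding t_def using that T01[OF that(1)] finTs by (intro Max_ge) auto
    have cT: "T \<inter> {0..t} = T \<inter> {0..s}" using tmax t by auto
    have A: "finite (components (- Y t)) \<and> card (components (- Y t)) \<le> Suc n"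
    proof (cases "T \<inter> {0..<t} = {}")
      case True
      \<comment> \<open>Up to the first crossing the arc is traversed backwards, so that its only
        point on the segment is its start.\<close>
      have im: "path_image (subpath t 0 g) = g ` {0..t}"
        using t by (simp add: path_image_subpath)
      have "?S \<inter> g ` {0..t} \<subseteq> {g t}"
      proof -
        have "u = t" if "u \<in> {0..t}" "g u \<in> ?S" for u
          using TS[of u] True that t by fastforce
        then show ?thesis by blast
      qed
      then have "?S \<inter> path_image (subpath t 0 g) \<subseteq> {pathstart (subpath t 0 g)}"
        unfolding im by simp
      then show ?thesis
        using components_Compl_Un_arc[OF compact_segment sub[of t 0] _ S1(1)] t S1(2) unfolding im Y_def by simp
    next
      case False
      have fin': "finite (T \<inter> {0..<t})" using finT by simp
      define t' where "t' = Max (T \<inter> {0..<t})"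
      have "t' \<in> T \<inter> {0..<t}" unfolding t'_def by (rule Max_in[OF fin' False])
      then have t': "t' \<in> T" "0 < t'" "t' < t" using T01 by auto
      have t'max: "u \<le> t'" if "u \<in> T" "u < t" for u
        unfolding t'_def using that T01[OF that(1)] fin' by (intro Max_ge) auto
      have cT': "T \<inter> {0..t'} = (T \<inter> {0..t}) - {t}" using t'max t' by force
      then have card': "card (T \<inter> {0..t'}) = n"
        using Suc(2) cT t finTs by (simp add: card_Diff_singleton)
      \<comment> \<open>The crossing time \<open>t'\<close> is counted by \<open>n\<close>, so the
        \<open>max 1\<close> in the induction hypothesis is just \<open>n\<close>.\<close>
      have "0 < n"
        using t' card' finT by (metis IntI atLeastAtMost_iff card_gt_0_iff empty_iff finite_Int less_eq_real_def)
      have IH: "finite (components (- Y t'))" "card (components (- Y t')) \<le> n"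
        using Suc(1)[of t'] card' t' t \<open>0 < n\<close> by auto
      have im: "path_image (subpath t' t g) = g ` {t'..t}"
        using t' by (simp add: path_image_subpath)
      have gS: "g t' \<in> ?S" "g t \<in> ?S" using TS t t' by auto
      have "Y t' \<inter> g ` {t'..t} = {g t', g t}"
      proof
        show "{g t', g t} \<subseteq> Y t' \<inter> g ` {t'..t}"
          using gS t' unfolding Y_def by auto
        show "Y t' \<inter> g ` {t'..t} \<subseteq> {g t', g t}"
        proof
          fix x assume x: "x \<in> Y t' \<inter> g ` {t'..t}"
          then obtain u where u: "x = g u" "t' \<le> u" "u \<le> t" by auto
          have "u = t' \<or> u = t"
          proof (cases "x \<in> ?S")
            case True
            then have "u \<in> T" using TS[of u] u t t' by simp
            then show ?thesis using t'max[of u] u by fastforce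
          next
            case False
            then have "x \<in> g ` {0..t'}" using x unfolding Y_def by blast
            then obtain v where "x = g v" "0 \<le> v" "v \<le> t'" by auto
            then have "u = v" using injD[of u v] u t t' by simp
            then show ?thesis using u \<open>v \<le> t'\<close> by simp
          qed
          then show "x \<in> {g t', g t}" using u by auto
        qed
      qed
      then have int: "Y t' \<inter> path_image (subpath t' t g) = {pathstart (subpath t' t g), pathfinish (subpath t' t g)}"
        unfolding im by simp
      \<comment> \<open>Both crossings lie on the straight segment, so by convexity the chord can be
        closed up inside \<open>Y t'\<close>.\<close>
      have seg: "closed_segment (pathstart (subpath t' t g)) (pathfinish (subpath t' t g)) \<subseteq> Y t'"
        using closed_segment_subset[OF gS convex_closed_segment] unfolding Y_def by simp blast
      have "Y t' \<union> path_image (subpath t' t g) = Y t"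
      proof -
        have "{0..t'} \<union> {t'..t} = {0..t}" using t' by auto
        then show ?thesis unfolding im Y_def by (metis Un_assoc image_Un)
      qed
      then show ?thesis
        using components_Compl_Un_chord[OF compactY sub IH(1) int seg] IH(2) t t' by simp
    qed
    show ?case
    proof (cases "s = t")
      case True
      then show ?thesis using A Suc(2) by simp
    next
      case False
      then have ts: "t < s" using t by simp
      have im: "path_image (subpath t s g) = g ` {t..s}"
        using ts by (simp add: path_image_subpath)
      have "Y t \<inter> g ` {t..s} \<subseteq> {g t}"
      proof
        fix x assume x: "x \<in> Y t \<inter> g ` {t..s}"
        then obtain u where u: "x = g u" "t \<le> u" "u \<le> s" by auto
        have "u = t"
        proof (cases "x \<in> ?S")
          case True
          then have "u \<in> T" using TS[of u] u t Suc by simp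
          then show ?thesis using tmax[of u] u by simp
        next
          case False
          then have "x \<in> g ` {0..t}" using x unfolding Y_def by blast
            then obtain v where "x = g v" "0 \<le> v" "v \<le> t" by auto
          then have "u = v" using injD[of u v] u t Suc by simp
          then show ?thesis using u \<open>v \<le> t\<close> by simp
        qed
        then show "x \<in> {g t}" using u by auto
      qed
      then have int: "Y t \<inter> path_image (subpath t s g) \<subseteq> {pathstart (subpath t s g)}"
        unfolding im by simp
      have "Y t \<union> path_image (subpath t s g) = Y s"
      proof -
        have "{0..t} \<union> {t..s} = {0..s}" using t by auto
        then show ?thesis unfolding im Y_def by (metis Un_assoc image_Un)
      qed
      then show ?thesis
        using components_Compl_Un_arc[OF compactY sub int] A Suc t ts by simp
    qed
  qed
qed

lemma card_regions_le:
  assumes d: "doubly_anchored_open_semi_meander g L"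
  shows "finite (regions g L)" "card (regions g L) \<le> max 1 (card (crossings g))"
proof -
  have "{t \<in> {0..1}. g t \<in> ray} \<inter> {0..1} = {t \<in> {0..1}. g t \<in> ray}" by blast
  then show "finite (regions g L)" "card (regions g L) \<le> max 1 (card (crossings g))"
    using partial_graph_components[OF d, of 1] card_crossings[OF d]
    unfolding regions_def meander_graph_def path_image_def by simp_all
qed

section \<open>The lower bound\<close>

lemma card_anchors:
  assumes d: "doubly_anchored_open_semi_meander g L"
  shows "finite (anchors g L)" "card (anchors g L) = 4"
proof -
  have "0 \<in> ray" "complex_of_real L \<in> ray"
    using doubly_anchoredD(2)[OF d] by (simp_all add: ray_def)
  moreover have "pathstart g \<notin> ray" "pathfinish g \<notin> ray"
    using d unfolding doubly_anchored_open_semi_meander_def open_semi_meander_def by auto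
  moreover have "pathstart g \<noteq> pathfinish g"
    using doubly_anchoredD(1)[OF d] arc_distinct_ends by metis
  moreover have "0 \<noteq> complex_of_real L" using doubly_anchoredD(2)[OF d] by simp
  ultimately have "distinct [0, complex_of_real L, pathstart g, pathfinish g]" by auto
  then have "card (set [0, complex_of_real L, pathstart g, pathfinish g]) = 4"
    using distinct_card by fastforce
  then show "card (anchors g L) = 4" "finite (anchors g L)" unfolding anchors_def by simp_all
qed

lemma size_orders:
  assumes d: "doubly_anchored_open_semi_meander g L"
  shows "size (orders g L) = card (regions g L) + 4"
  using card_anchors[OF d] unfolding orders_def by simp

text \<open>Of the \<open>k1 + k2 + 6 + z\<close> orders four come from the anchors, so additional
  4-gons only raise the number of regions. There are at least two regions, which rules out the value
  1 of the \<open>max\<close> in the region bound.\<close>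

lemma stratum_lower_bound:
  fixes k1 k2 :: nat
  assumes d: "doubly_anchored_open_semi_meander g L"
    and st: "in_stratum g L ({#int k1, int k2#} + replicate_mset (k1 + k2 + 4) (- 1))"
  shows "k1 + k2 + 2 \<le> card (crossings g)"
proof -
  obtain z where "orders g L = {#int k1, int k2#} + replicate_mset (k1 + k2 + 4) (- 1) + replicate_mset z 0"
    using st unfolding in_stratum_def by blast
  then have "size (orders g L) = k1 + k2 + 6 + z" by simp
  then show ?thesis using size_orders[OF d] card_regions_le(2)[OF d] by simp
qed

section \<open>Polar coordinates\<close>

lemma rcis_eq_imp:
  assumes "rcis r a = rcis r' b" "0 < r" "0 < r'" "\<bar>a - b\<bar> < 2 * pi"
  shows "r = r' \<and> a = b"
proof -
  have r: "r = r'" using arg_cong[OF assms(1), of cmod] assms(2,3) by simp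
  then have "cis a = cis b" using assms(1,2) by (simp add: rcis_def)
  then have "cos (a - b) = 1"
    by (simp add: cos_diff complex_eq_iff flip: power2_eq_square)
  then obtain k :: int where k: "a - b = k * (2 * pi)" by (auto simp: cos_one_2pi_int)
  then have "\<bar>real_of_int k\<bar> * (2 * pi) < 1 * (2 * pi)" using assms(4) by (simp add: abs_mult)
  then have "\<bar>real_of_int k\<bar> < 1" by simp
  then have "k = 0" by linarith
  then show ?thesis using r k by simp
qed

lemma rcis_in_ray_iff:
  assumes "0 < r" "\<bar>a\<bar> < 2 * pi"
  shows "rcis r a \<in> ray \<longleftrightarrow> a = 0"
proof
  assume "rcis r a \<in> ray"
  then have "rcis r a = complex_of_real (Re (rcis r a))" "0 \<le> Re (rcis r a)"
    by (simp_all add: ray_def complex_eq_iff)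
  then have "rcis r a = rcis r 0"
    by (metis assms(1) abs_of_nonneg abs_of_pos complex_mod_rcis norm_of_real rcis_zero_arg)
  then show "a = 0" using rcis_eq_imp[of r a r 0] assms by simp
qed (use assms in \<open>simp add: ray_def\<close>)

section \<open>The extremal arc\<close>

text \<open>The excursions of the arc, that is, its angle up to full turns outside the annulus
  \<open>m < |z| < m + 1\<close>.\<close>

definition wobble :: "nat \<Rightarrow> real \<Rightarrow> real" where
  "wobble m r = sin (pi * (min r m - m)) + sin (pi * (max r (real m + 1) - (real m + 1)))"

text \<open>The clamped summand performs the full turn, at constant speed, while \<open>r\<close>
  runs from \<open>m\<close> to \<open>m + 1\<close>; in that range both sine terms of
  \<open>wobble\<close> have argument 0.\<close>

definition angle :: "nat \<Rightarrow> real \<Rightarrow> real" where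
  "angle m r = wobble m r + 2 * pi * (min (max r m) (real m + 1) - m)"

definition spiral :: "nat \<Rightarrow> real \<Rightarrow> complex" where
  "spiral m r = rcis r (angle m r)"

text \<open>The spiral meets the ray at integral radii only, so end radii half way between integers
  keep the ends of the arc off the ray.\<close>

definition meander :: "nat \<Rightarrow> nat \<Rightarrow> real \<Rightarrow> complex" where
  "meander n m t = spiral m (1/2 + n * t)"

lemma wobble_cases:
  "(r::real) \<le> m \<Longrightarrow> wobble m r = sin (pi * (r - m))"
  "m \<le> r \<Longrightarrow> r \<le> real m + 1 \<Longrightarrow> wobble m r = 0"
  "real m + 1 \<le> r \<Longrightarrow> wobble m r = sin (pi * (r - (real m + 1)))"
  by (auto simp: wobble_def)

lemma angle_cases:
  "(r::real) \<le> m \<Longrightarrow> angle m r = wobble m r"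
  "m \<le> r \<Longrightarrow> r \<le> real m + 1 \<Longrightarrow> angle m r = 2 * pi * (r - m)"
  "real m + 1 \<le> r \<Longrightarrow> angle m r = wobble m r + 2 * pi"
  by (auto simp: angle_def wobble_cases)

lemma cis_angle: "(r::real) \<le> m \<or> real m + 1 \<le> r \<Longrightarrow> cis (angle m r) = cis (wobble m r)"
  by (auto simp: angle_cases cis_mult[symmetric])

text \<open>An amplitude below \<pi> / 2 keeps every excursion in the right half-plane; in
  particular \<open>cis\<close> is injective on the angles involved.\<close>

lemma abs_wobble_le: "\<bar>wobble m r\<bar> \<le> 1"
  using wobble_cases[where r = r and m = m] by (cases "r \<le> m"; cases "r \<le> real m + 1") auto

lemma sin_pi_times_eq_0_iff: "sin (pi * x) = 0 \<longleftrightarrow> x \<in> \<int>"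
  using sin_times_pi_eq_0[of x] by (simp add: mult.commute)

lemma wobble_eq_0_iff: "wobble m r = 0 \<longleftrightarrow> r \<in> \<int> \<or> (real m \<le> r \<and> r \<le> real m + 1)"
proof -
  consider "r \<le> real m" | "real m < r" "r < real m + 1" | "real m + 1 \<le> r" by linarith
  then show ?thesis
  proof cases
    case 1
    have "r - real m \<in> \<int> \<longleftrightarrow> r \<in> \<int>"
      using Ints_add[of "r - real m" "real m"] Ints_diff[of r "real m"] by auto
    then show ?thesis
      using sin_pi_times_eq_0_iff[of "r - real m"] wobble_cases(1)[OF 1] 1 Ints_of_nat[of m] by auto
  next
    case 2
    then show ?thesis by (simp add: wobble_cases)
  next
    case 3
    have "r - (real m + 1) \<in> \<int> \<longleftrightarrow> r \<in> \<int>"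
      using Ints_add[of "r - (real m + 1)" "real m + 1"] Ints_diff[of r "real m + 1"] by auto
    moreover have "r \<in> \<int>" if "r \<le> real m + 1"
    proof -
      have "r = real (Suc m)" using that 3 by simp
      then show ?thesis by (simp only: Ints_of_nat)
    qed
    ultimately show ?thesis
      using sin_pi_times_eq_0_iff[of "r - (real m + 1)"] wobble_cases(3)[OF 3] 3 by auto
  qed
qed

lemma continuous_on_wobble [continuous_intros]:
  fixes f :: "'a::t2_space \<Rightarrow> real"
  shows "continuous_on S f \<Longrightarrow> continuous_on S (\<lambda>x. wobble m (f x))"
  unfolding wobble_def by (intro continuous_on_add continuous_on_sin continuous_on_mult continuous_on_diff continuous_on_min continuous_on_max continuous_on_const)

lemma norm_spiral: "cmod (spiral m r) = \<bar>r\<bar>"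
  by (simp add: spiral_def complex_mod_rcis)

lemma continuous_on_spiral: "continuous_on S (spiral m)"
  unfolding spiral_def rcis_def angle_def by (intro continuous_on_min continuous_on_max continuous_intros)

lemma path_image_meander:
  assumes "0 < n"
  shows "path_image (meander n m) = spiral m ` {1/2..n + 1/2}"
proof -
  have "(\<lambda>t::real. 1/2 + n * t) ` {0..1} = {1/2..n + 1/2 :: real}"
    using assms image_affinity_atLeastAtMost[of "real n" "1/2" 0 "1::real"] by (simp add: add.commute)
  moreover have "meander n m = spiral m \<circ> (\<lambda>t::real. 1/2 + n * t)" by (simp add: meander_def fun_eq_iff)
  ultimately show ?thesis unfolding path_image_def by (simp only: image_comp[symmetric])
qed

lemma spiral_in_ray_iff:
  assumes "0 < r"
  shows "spiral m r \<in> ray \<longleftrightarrow> r \<in> \<int>"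
proof -
  have w: "\<bar>wobble m r\<bar> < 2 * pi" using abs_wobble_le[of m r] pi_gt3 by linarith
  consider "r \<le> real m \<or> real m + 1 \<le> r" | "m < r" "r < real m + 1" by linarith
  then show ?thesis
  proof cases
    case 1
    then have "spiral m r = rcis r (wobble m r)" by (simp add: spiral_def rcis_def cis_angle)
    \<comment> \<open>In this case the second alternative for a zero of \<open>wobble\<close> can
      occur only at \<open>r = m\<close> or \<open>r = m + 1\<close>, which are integers
      anyway.\<close>
    moreover have "r \<in> \<int>" if "m \<le> r" "r \<le> real m + 1"
      using 1 that by (metis Ints_of_nat Ints_add Ints_1 order_antisym)
    ultimately show ?thesis using rcis_in_ray_iff[OF assms w] wobble_eq_0_iff[of m r] by auto
  next
    case 2
    have "\<bar>2 * pi * (r - m)\<bar> < 2 * pi" using 2 by (simp add: abs_mult)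
    moreover have "r \<notin> \<int>"
    proof
      assume "r \<in> \<int>"
      then obtain k :: int where "r = k" by (metis Ints_cases)
      then have "int m < k" "k < int m + 1" using 2 by linarith+
      then show False by linarith
    qed
    ultimately show ?thesis
      using rcis_in_ray_iff[OF assms, of "2 * pi * (r - m)"] 2 by (simp add: spiral_def angle_cases)
  qed
qed

lemma times_sin_pos:
  fixes y :: real
  assumes "y \<noteq> 0" "\<bar>y\<bar> < pi"
  shows "0 < y * sin y"
proof (cases "0 < y")
  case True
  then show ?thesis using assms sin_gt_zero[of y] by simp
next
  case False
  then show ?thesis using assms sin_gt_zero[of "- y"] by (simp add: zero_less_mult_iff)
qed

text \<open>Shifting the argument by an integral multiple of \<pi> changes the sine by a sign, and
  the sign is \<open>cos (pi * (b - a))\<close>.\<close>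

lemma sin_pi_times_shift:
  assumes "b - a \<in> \<int>"
  shows "cos (pi * (b - a)) * sin (pi * (r - a)) = sin (pi * (r - b))"
proof -
  have s0: "sin (pi * (b - a)) = 0" using sin_pi_times_eq_0_iff assms by blast
  have e: "pi * (r - a) = pi * (r - b) + pi * (b - a)" by (simp add: algebra_simps)
  have "cos (pi * (b - a)) * sin (pi * (r - a)) = sin (pi * (r - b)) * (cos (pi * (b - a)))\<^sup>2"
    unfolding e sin_add s0 by (simp add: power2_eq_square)
  also have "(cos (pi * (b - a)))\<^sup>2 = 1" using sin_cos_squared_add[of "pi * (b - a)"] s0 by simp
  finally show ?thesis by simp
qed

text \<open>The constant \<open>c\<close> only carries the direction of the crossing at \<open>k\<close>.\<close>

lemma Im_spiral_sign:
  fixes k m :: nat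
  obtains c :: real where "\<And>r::real. 0 < r \<Longrightarrow> \<bar>r - k\<bar> < 1/2 \<Longrightarrow> r \<noteq> k \<Longrightarrow> 0 < c * ((r - k) * Im (spiral m r))"
proof -
  \<comment> \<open>Close to \<open>k\<close> and outside the middle annulus, the excursions follow
    the sine wave based at \<open>a\<close>.\<close>
  define a where "a = (if k \<le> m then real m else real m + 1)"
  have int: "real k - a \<in> \<int>" by (simp add: a_def)
  have "0 < cos (pi * (k - a)) * ((r - k) * Im (spiral m r))"
    if r: "0 < r" "\<bar>r - k\<bar> < 1/2" "r \<noteq> k" for r :: real
  proof (cases "real m < r \<and> r < real m + 1")
    case True
    then have "real k < real (m + 2)" "real m < real (k + 1)" using True r by linarith+
    \<comment> \<open>A radius in the middle annulus within 1/2 of \<open>k\<close> forces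
      \<open>k\<close> to be one of the two bounding radii, so \<open>k = a\<close> and the constant
      is \<open>cos 0 = 1\<close>.\<close>
    then have "k = m \<or> k = m + 1" unfolding of_nat_less_iff by linarith
    then have k: "real k = a" by (auto simp: a_def)
    have "Im (spiral m r) = r * sin (2 * pi * (r - m))"
      using True by (simp add: spiral_def angle_cases)
    also have "sin (2 * pi * (r - m)) = sin (2 * pi * (r - k))"
    proof (cases "k \<le> m")
      case False
      then have "2 * pi * (r - m) = 2 * pi * (r - k) + 2 * pi"
        using k by (simp add: a_def algebra_simps)
      then show ?thesis by (simp only: sin_periodic)
    qed (use k in \<open>simp add: a_def\<close>)
    finally have Im: "Im (spiral m r) = r * sin (2 * pi * (r - k))" .
    \<comment> \<open>The distance 1/2 in the statement comes from here: the angle turns by 2\<pi>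
      per unit of radius and may differ from that at \<open>k\<close> by less than \<pi>.\<close>
    have "\<bar>2 * pi * (r - k)\<bar> < pi" using r by (simp add: abs_mult)
    then have "0 < 2 * pi * (r - k) * sin (2 * pi * (r - k))"
      using r by (intro times_sin_pos) auto
    then have "0 < (r - k) * sin (2 * pi * (r - k))"
      by (simp add: mult.assoc zero_less_mult_iff[of "2 * pi"] zero_less_mult_iff[of pi])
    then have "0 < r * ((r - k) * sin (2 * pi * (r - k)))" using r by simp
    then show ?thesis unfolding Im using k by (simp add: mult.left_commute)
  next
    case False
    then have rm: "r \<le> real m \<or> real m + 1 \<le> r" by linarith
    have Im: "Im (spiral m r) = r * sin (wobble m r)"
      using arg_cong[OF cis_angle[OF rm], of Im] by (simp add: spiral_def)
    have w: "wobble m r = sin (pi * (r - a))"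
    proof (cases "k \<le> m")
      case True
      then have "r \<le> m" using r rm by linarith
      then show ?thesis using True by (simp add: wobble_cases a_def)
    next
      case False
      then have "real m + 1 \<le> real k" by linarith
      then have "real m + 1 \<le> r" using r rm by linarith
      then show ?thesis using False by (simp add: wobble_cases a_def)
    qed
    have eq: "cos (pi * (k - a)) * wobble m r = sin (pi * (r - k))"
      unfolding w by (rule sin_pi_times_shift[OF int])
    have "\<bar>pi * (r - k)\<bar> < pi" using r by (simp add: abs_mult)
    then have "0 < pi * (r - k) * sin (pi * (r - k))"
      using r by (intro times_sin_pos) auto
    then have A: "0 < (r - k) * (cos (pi * (k - a)) * wobble m r)"
      unfolding eq by (simp add: mult.assoc zero_less_mult_iff[of pi])
    then have w0: "wobble m r \<noteq> 0" by auto
    have "\<bar>wobble m r\<bar> < pi" using abs_wobble_le[of m r] pi_gt3 by linarith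
    then have B: "0 < wobble m r * sin (wobble m r)" using w0 by (intro times_sin_pos)
    \<comment> \<open>The product of \<open>r\<close> with the positive quantities of
      \<open>A\<close> and \<open>B\<close> is the desired expression times
      \<open>(wobble m r)\<^sup>2\<close>.\<close>
    have "0 < r * (((r - k) * (cos (pi * (k - a)) * wobble m r)) * (wobble m r * sin (wobble m r)))"
      using A B r by simp
    also have "\<dots> = (wobble m r)\<^sup>2 * (cos (pi * (k - a)) * ((r - k) * Im (spiral m r)))"
      unfolding Im by (simp add: power2_eq_square)
    finally show ?thesis using w0 by (simp add: zero_less_mult_iff)
  qed
  then show thesis using that by blast
qed

lemma meander_crosses:
  assumes n: "0 < n" and k: "0 < k" and t: "1/2 + n * t = real k"
  shows "crosses_transversally (meander n m) t"
proof -
  obtain c where c: "\<And>r::real. 0 < r \<Longrightarrow> \<bar>r - k\<bar> < 1/2 \<Longrightarrow> r \<noteq> k \<Longrightarrow> 0 < c * ((r - k) * Im (spiral m r))"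
    using Im_spiral_sign[of k m] by blast
  have pos: "0 < c * ((s - t) * Im (meander n m s))" if "\<bar>s - t\<bar> < 1 / (2 * n)" "s \<noteq> t" for s :: real
  proof -
    have r: "(1/2 + n * s) - k = n * (s - t)" unfolding t[symmetric] by (simp add: algebra_simps)
    have "n * \<bar>s - t\<bar> < 1/2" using that n by (simp add: field_simps)
    then have ab: "\<bar>(1/2 + n * s) - k\<bar> < 1/2" unfolding r by (simp add: abs_mult)
    then have "0 < 1/2 + n * s" using k by linarith
    moreover have "1/2 + n * s \<noteq> k"
    proof -
      have "n * (s - t) \<noteq> 0" using that n by simp
      then show ?thesis using r by linarith
    qed
    ultimately have "0 < c * (n * (s - t) * Im (spiral m (1/2 + n * s)))" using c[OF _ ab] unfolding r by blast
    then have "0 < n * (c * ((s - t) * Im (meander n m s)))" by (simp add: meander_def mult_ac)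
    then show ?thesis using n by (simp add: zero_less_mult_iff)
  qed
  \<comment> \<open>During time \<open>e\<close> the radius changes by 1/2, the range in which the
    sign of the imaginary part is known.\<close>
  define e where "e = 1 / (2 * real n)"
  have e: "0 < e" using n by (simp add: e_def)
  then have l: "\<forall>\<^sub>F s in at_left t. s \<in> {t - e<..<t}" and r: "\<forall>\<^sub>F s in at_right t. s \<in> {t<..<t + e}"
    by (auto intro!: eventually_at_leftI[of "t - e"] eventually_at_rightI[of _ "t + e"])
  have left: "c * Im (meander n m s) < 0" if "s \<in> {t - e<..<t}" for s
  proof -
    have "0 < c * ((s - t) * Im (meander n m s))" using that by (intro pos) (auto simp: e_def)
    then have "0 < (s - t) * (c * Im (meander n m s))" by (simp add: mult.left_commute)
    then show ?thesis using that by (auto simp: zero_less_mult_iff)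
  qed
  have right: "0 < c * Im (meander n m s)" if "s \<in> {t<..<t + e}" for s
  proof -
    have "0 < c * ((s - t) * Im (meander n m s))" using that by (intro pos) (auto simp: e_def)
    then have "0 < (s - t) * (c * Im (meander n m s))" by (simp add: mult.left_commute)
    then show ?thesis using that by (auto simp: zero_less_mult_iff)
  qed
  have "c \<noteq> 0" using right[of "t + e / 2"] e by auto
  then consider "0 < c" | "c < 0" by linarith
  then show ?thesis
  proof cases
    case 1
    have "\<forall>\<^sub>F s in at_left t. Im (meander n m s) < 0"
      using l by eventually_elim (use left 1 in \<open>simp add: mult_less_0_iff\<close>)
    moreover have "\<forall>\<^sub>F s in at_right t. 0 < Im (meander n m s)"
      using r by eventually_elim (use right 1 in \<open>simp add: zero_less_mult_iff\<close>)
    ultimately show ?thesis unfolding crosses_transversally_def by blast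
  next
    case 2
    have "\<forall>\<^sub>F s in at_left t. 0 < Im (meander n m s)"
      using l by eventually_elim (use left 2 in \<open>simp add: mult_less_0_iff\<close>)
    moreover have "\<forall>\<^sub>F s in at_right t. Im (meander n m s) < 0"
      using r by eventually_elim (use right 2 in \<open>simp add: zero_less_mult_iff\<close>)
    ultimately show ?thesis unfolding crosses_transversally_def by blast
  qed
qed

section \<open>The arc as a doubly-anchored semi-meander\<close>

lemma spiral_of_nat:
  "spiral m (real k) = of_real k"
proof -
  have "spiral m k \<in> ray \<or> k = 0" using spiral_in_ray_iff[of "real k" m] by (cases "k = 0") auto
  then show ?thesis
  proof
    assume "spiral m k \<in> ray"
    then have "spiral m k = of_real (Re (spiral m k))" "0 \<le> Re (spiral m k)"
      by (simp_all add: ray_def complex_eq_iff)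
    then show ?thesis using norm_spiral[of m k] by (metis abs_of_nat abs_of_nonneg norm_of_real)
  qed (simp add: spiral_def)
qed

lemma real_Ints_interval: "{r \<in> {1/2..real n + 1/2}. r \<in> \<int>} = real ` {1..n}"
proof
  show "{r \<in> {1/2..real n + 1/2}. r \<in> \<int>} \<subseteq> real ` {1..n}"
  proof
    fix r assume "r \<in> {r \<in> {1/2..real n + 1/2}. r \<in> \<int>}"
    then obtain k :: int where k: "r = k" "1/2 \<le> real_of_int k" "k \<le> real n + 1/2" by (auto elim: Ints_cases)
    then have "1 \<le> k" "k \<le> int n" by linarith+
    then have "r = real (nat k)" "nat k \<in> {1..n}" using k by auto
    then show "r \<in> real ` {1..n}" by blast
  qed
qed auto

lemma crossings_meander:
  assumes "0 < n"
  shows "crossings (meander n m) = of_nat ` {1..n}"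
proof -
  have "crossings (meander n m) = spiral m ` {r \<in> {1/2..real n + 1/2}. spiral m r \<in> ray}"
    unfolding crossings_def path_image_meander[OF assms] by blast
  also have "{r \<in> {1/2..real n + 1/2}. spiral m r \<in> ray} = {r \<in> {1/2..real n + 1/2}. r \<in> \<int>}"
    using spiral_in_ray_iff by auto
  finally show ?thesis unfolding real_Ints_interval by (simp add: image_image spiral_of_nat)
qed

text \<open>The modulus recovers the parameter, so the arc is simple whatever its angle
  does.\<close>

lemma inj_on_spiral: "inj_on (spiral m) {0..}"
  by (rule inj_onI) (metis norm_spiral abs_of_nonneg atLeast_iff)

lemma arc_meander:
  assumes "0 < n"
  shows "arc (meander n m)"
  unfolding arc_def
proof
  have m: "meander n m = spiral m \<circ> (\<lambda>t::real. 1/2 + n * t)" by (simp add: meander_def fun_eq_iff)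
  show "path (meander n m)"
    unfolding path_def m by (intro continuous_on_compose continuous_on_spiral continuous_intros)
  show "inj_on (meander n m) {0..1}"
  proof (rule inj_onI)
    fix s t :: real
    assume st: "s \<in> {0..1}" "t \<in> {0..1}" "meander n m s = meander n m t"
    then have "1/2 + n * s = 1/2 + n * t"
      by (intro inj_onD[OF inj_on_spiral[of m]]) (auto simp: meander_def)
    then show "s = t" using assms by simp
  qed
qed

lemma half_notin_Ints: "real k + 1/2 \<notin> \<int>"
proof
  assume "real k + 1/2 \<in> \<int>"
  then obtain j :: int where j: "real k + 1/2 = j" by (metis Ints_cases)
  then have "int k < j" "j < int k + 1" by linarith+
  then show False by linarith
qed

lemma meander_doubly_anchored:
  assumes n: "0 < n"
  shows "doubly_anchored_open_semi_meander (meander n m) (real n + 1)"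
proof -
  have "pathstart (meander n m) \<notin> ray" "pathfinish (meander n m) \<notin> ray"
    using spiral_in_ray_iff[of "1/2" m] spiral_in_ray_iff[of "n + 1/2" m] half_notin_Ints[of 0] half_notin_Ints[of n]
    by (simp_all add: pathstart_def pathfinish_def meander_def add.commute)
  moreover have "0 \<notin> path_image (meander n m)"
  proof
    assume "0 \<in> path_image (meander n m)"
    then obtain r where "1/2 \<le> r" "spiral m r = 0" unfolding path_image_meander[OF n] by auto
    then show False using norm_spiral[of m r] by simp
  qed
  moreover have "crosses_transversally (meander n m) t" if t: "t \<in> {0<..<1}" "meander n m t \<in> ray" for t
  proof -
    let ?r = "1/2 + n * t"
    have r: "0 < ?r" "1/2 \<le> ?r" "?r \<le> n + 1/2" using t by (auto intro: add_pos_nonneg mult_left_le)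
    then have "?r \<in> \<int>" using t spiral_in_ray_iff[of ?r m] by (simp add: meander_def)
    then have "?r \<in> real ` {1..n}" using r unfolding real_Ints_interval[symmetric] by simp
    then obtain k where k: "?r = real k" "1 \<le> k" by auto
    then show ?thesis using meander_crosses[OF n, of k t m] by simp
  qed
  moreover have "crossings (meander n m) \<subseteq> open_segment 0 (complex_of_real (real n + 1))"
  proof -
    have "of_nat k \<in> open_segment 0 (complex_of_real (real n + 1))" if "k \<in> {1..n}" for k
      unfolding in_segment(2) using that
      by (intro conjI exI[of _ "k / (real n + 1)"]) (auto simp: scaleR_conv_of_real complex_eq_iff add_pos_nonneg field_simps)
    then show ?thesis unfolding crossings_meander[OF n] by auto
  qed
  ultimately show ?thesis
    unfolding doubly_anchored_open_semi_meander_def open_semi_meander_def using arc_meander[OF n] by auto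
qed

section \<open>Its regions\<close>

definition spiral_graph :: "nat \<Rightarrow> nat \<Rightarrow> complex set" where
  "spiral_graph n m = meander_graph (meander n m) (real n + 1)"

lemma spiral_graph_eq:
  assumes "0 < n"
  shows "spiral_graph n m = of_real ` {0..real n + 1} \<union> spiral m ` {1/2..n + 1/2}"
proof -
  have "closed_segment 0 (complex_of_real (real n + 1)) = of_real ` {0..real n + 1}"
    using closed_segment_of_real[of 0 "real n + 1", where ?'a = complex] by (simp add: closed_segment_eq_real_ivl)
  then show ?thesis by (simp add: spiral_graph_def meander_graph_def path_image_meander[OF assms])
qed

lemma rcis_eq_iff_cis:
  assumes "0 < r" "0 \<le> r'"
  shows "rcis r a = rcis r' b \<longleftrightarrow> r = r' \<and> cis a = cis b"
proof
  assume eq: "rcis r a = rcis r' b"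
  have "r = r'" using arg_cong[OF eq, of cmod] assms by simp
  then show "r = r' \<and> cis a = cis b" using eq assms by (simp add: rcis_def)
qed (simp add: rcis_def)

lemma rcis_in_spiral_graph_iff:
  assumes "0 < n" "0 < r"
  shows "rcis r a \<in> spiral_graph n m \<longleftrightarrow>
    (r \<le> real n + 1 \<and> cis a = 1) \<or> (1/2 \<le> r \<and> r \<le> n + 1/2 \<and> cis a = cis (angle m r))"
proof -
  have "rcis r a \<in> of_real ` {0..real n + 1} \<longleftrightarrow> r \<le> real n + 1 \<and> cis a = 1"
    using assms rcis_eq_iff_cis[of r _ a 0] by (auto simp: image_iff rcis_zero_arg[symmetric] simp del: rcis_zero_arg)
  moreover have "rcis r a \<in> spiral m ` {1/2..n + 1/2} \<longleftrightarrow> 1/2 \<le> r \<and> r \<le> n + 1/2 \<and> cis a = cis (angle m r)"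
    using assms rcis_eq_iff_cis[of r _ a] by (auto simp: image_iff spiral_def)
  ultimately show ?thesis unfolding spiral_graph_eq[OF assms(1)] by blast
qed

text \<open>The parameter \<open>t\<close> moves the angle from the ray (\<open>t = 0\<close>) to
  the arc (\<open>t = 1\<close>), and the sign of \<open>wobble\<close> takes care of the side of
  the ray. For \<open>j = m\<close> the set collapses to a piece of the ray, so that index is always
  excluded.\<close>

definition bigon :: "nat \<Rightarrow> nat \<Rightarrow> complex set" where
  "bigon m j = (\<lambda>(r, t). rcis r (t * wobble m r)) ` ({j<..<real j + 1} \<times> {0<..<1})"

definition closed_bigon :: "nat \<Rightarrow> nat \<Rightarrow> complex set" where
  "closed_bigon m j = (\<lambda>(r, t). rcis r (t * wobble m r)) ` ({j..real j + 1} \<times> {0..1})"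

text \<open>The sets \<open>|z| \<le> m + arg z / 2\<pi>\<close> and \<open>|z| \<ge> m + arg z / 2\<pi>\<close>, where a point of the positive real axis
  belongs to them if the inequality holds for either of its arguments \<open>0\<close> and \<open>2\<pi>\<close>. This makes both
  of them closed.\<close>

definition inner_disc :: "nat \<Rightarrow> complex set" where
  "inner_disc m = (\<lambda>(r, a). rcis r a) ` {(r, a). 0 \<le> r \<and> r \<le> real m + 1 \<and> 0 \<le> a \<and> a \<le> 2 * pi \<and> 2 * pi * (r - m) \<le> a}"

definition outer_disc :: "nat \<Rightarrow> complex set" where
  "outer_disc m = {z. real m + 1 \<le> cmod z} \<union>
     (\<lambda>(r, a). rcis r a) ` {(r, a). 0 \<le> r \<and> r \<le> real m + 1 \<and> 0 \<le> a \<and> a \<le> 2 * pi \<and> a \<le> 2 * pi * (r - m)}"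

text \<open>Both regions are written as complements of closed sets, so they are open without a
  separate look at the positive real axis, where the argument jumps.\<close>

definition inner_region :: "nat \<Rightarrow> nat \<Rightarrow> complex set" where
  "inner_region n m = - (spiral_graph n m \<union> outer_disc m \<union> (\<Union>j\<in>{1..<n} - {m}. closed_bigon m j))"

definition outer_region :: "nat \<Rightarrow> nat \<Rightarrow> complex set" where
  "outer_region n m = - (spiral_graph n m \<union> inner_disc m \<union> (\<Union>j\<in>{1..<n} - {m}. closed_bigon m j))"

lemma continuous_on_rcis: "continuous_on S (\<lambda>(r, a). rcis r a)"
  unfolding rcis_def case_prod_unfold by (intro continuous_intros)

lemma compact_closed_bigon: "compact (closed_bigon m j)"
  unfolding closed_bigon_def case_prod_unfold rcis_def
  by (intro compact_continuous_image compact_Times compact_Icc continuous_intros)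

text \<open>Allowing both angles 0 and 2\<pi> makes the parameter set compact; its image is then
  closed even though the polar map is not injective.\<close>

lemma compact_polar: 
  assumes "closed C"
  shows "compact ((\<lambda>(r, a). rcis r a) ` ({0..R} \<times> {0..2 * pi} \<inter> C))"
  by (intro compact_continuous_image continuous_on_rcis compact_Int_closed compact_Times compact_Icc assms)

lemma inner_disc_eq:
  "inner_disc m = (\<lambda>(r, a). rcis r a) ` ({0..real m + 1} \<times> {0..2 * pi} \<inter> {p. 2 * pi * (fst p - m) \<le> snd p})"
  unfolding inner_disc_def by (rule arg_cong[where f = "image _"]) auto

lemma closed_inner_disc: "closed (inner_disc m)"
  unfolding inner_disc_eq
  by (intro compact_imp_closed compact_polar closed_Collect_le continuous_intros)

lemma outer_disc_eq:
  "outer_disc m = {z. real m + 1 \<le> cmod z} \<union>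
     (\<lambda>(r, a). rcis r a) ` ({0..real m + 1} \<times> {0..2 * pi} \<inter> {p. snd p \<le> 2 * pi * (fst p - m)})"
  unfolding outer_disc_def by (rule arg_cong[where f = "\<lambda>S. _ \<union> _ ` S"]) auto

lemma closed_outer_disc: "closed (outer_disc m)"
  unfolding outer_disc_eq
  by (intro closed_Un compact_imp_closed[OF compact_polar] closed_Collect_le continuous_intros)

lemma closed_spiral_graph: "0 < n \<Longrightarrow> closed (spiral_graph n m)"
  unfolding spiral_graph_eq
  by (intro closed_Un compact_imp_closed compact_continuous_image continuous_on_spiral compact_Icc continuous_intros)

lemma open_inner_outer_region:
  assumes "0 < n"
  shows "open (inner_region n m)" "open (outer_region n m)"
proof -
  have "closed (\<Union>j\<in>{1..<n} - {m}. closed_bigon m j)"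
    by (intro closed_UN ballI compact_imp_closed compact_closed_bigon) simp
  then show "open (inner_region n m)" "open (outer_region n m)"
    unfolding inner_region_def outer_region_def
    using closed_spiral_graph[OF assms] closed_outer_disc closed_inner_disc
    by (simp_all only: open_Compl closed_Un)
qed

lemma rcis_Arg2pi: "rcis (cmod z) (Arg2pi z) = z"
  using Arg2pi_eq[of z] by (simp add: rcis_def cis_conv_exp)

lemma inner_Un_outer_disc: "inner_disc m \<union> outer_disc m = UNIV"
proof -
  have "z \<in> inner_disc m \<union> outer_disc m" for z
  proof (cases "real m + 1 \<le> cmod z")
    case False
    have "0 \<le> Arg2pi z" "Arg2pi z \<le> 2 * pi" using Arg2pi[of z] by auto
    then have "rcis (cmod z) (Arg2pi z) \<in> inner_disc m \<union> outer_disc m"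
      using False unfolding inner_disc_def outer_disc_def
      by (cases "2 * pi * (cmod z - m) \<le> Arg2pi z") (auto simp del: complex_mod_rcis)
    then show ?thesis by (simp add: rcis_Arg2pi)
  qed (simp add: outer_disc_def)
  then show ?thesis by blast
qed

lemma norm_inner_disc: "z \<in> inner_disc m \<Longrightarrow> cmod z \<le> real m + 1"
  unfolding inner_disc_def by auto

lemma norm_outer_disc: 
  assumes "z \<in> outer_disc m" shows "real m \<le> cmod z"
proof (cases "real m + 1 \<le> cmod z")
  case False
  then obtain r a where "z = rcis r a" "0 \<le> r" "0 \<le> a" "a \<le> 2 * pi * (r - m)"
    using assms unfolding outer_disc_def by auto
  moreover from this have "0 \<le> 2 * pi * (r - m)" by linarith
  ultimately show ?thesis using pi_gt_zero by (simp add: zero_le_mult_iff)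
qed simp

text \<open>A common point has modulus at least \<open>m\<close> and at most \<open>m + 1\<close>.
  Off the positive real axis its argument in \<open>(0, 2 * pi)\<close> is unique, so both
  inequalities concern the same angle and put the point on the arc; on the axis it belongs to the
  ray.\<close>

lemma inner_Int_outer_disc:
  assumes m: "0 < m" "m < n"
  shows "inner_disc m \<inter> outer_disc m \<subseteq> spiral_graph n m"
proof
  fix z assume z: "z \<in> inner_disc m \<inter> outer_disc m"
  then obtain r a where ra: "z = rcis r a" "0 \<le> r" "r \<le> real m + 1" "0 \<le> a" "a \<le> 2 * pi" "2 * pi * (r - m) \<le> a"
    unfolding inner_disc_def by auto
  have rm: "real m \<le> r" using norm_outer_disc[of z m] z ra by simp
  then have r: "0 < r" using m by simp
  show "z \<in> spiral_graph n m"
  proof (cases "a = 2 * pi * (r - m) \<or> cis a = 1")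
    case True
    then show ?thesis
      using rcis_in_spiral_graph_iff[of n r a m] r ra rm m by (auto simp: angle_cases)
  next
    case False
    then have a: "2 * pi * (r - m) < a" "a < 2 * pi" using ra by (auto simp: less_le)
    then have "2 * pi * (r - m) < 2 * pi * 1" by linarith
    then have "r < real m + 1" by (simp add: mult_less_cancel_left_pos)
    then obtain r' b where b: "z = rcis r' b" "0 \<le> r'" "0 \<le> b" "b \<le> 2 * pi * (r' - m)"
      using z ra r unfolding outer_disc_def by auto
    then have "r = r'" "cis a = cis b" using rcis_eq_iff_cis[of r r' a b] r ra by auto
    then have "a = b" using rcis_eq_imp[of r a r' b] b ra r a by auto
    then show ?thesis using b a \<open>r = r'\<close> by simp
  qed
qed


section \<open>The bigons\<close>

lemma abs_times_wobble_le:
  assumes "t \<in> {0..1}"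
  shows "\<bar>t * wobble m r\<bar> \<le> 1"
  using mult_mono[of "\<bar>t\<bar>" 1 "\<bar>wobble m r\<bar>" 1] assms abs_wobble_le[of m r] by (simp add: abs_mult)

lemma norm_closed_bigon: "z \<in> closed_bigon m j \<Longrightarrow> j \<le> cmod z \<and> cmod z \<le> real j + 1"
  unfolding closed_bigon_def by auto

lemma norm_bigon: "z \<in> bigon m j \<Longrightarrow> j < cmod z \<and> cmod z < real j + 1"
  unfolding bigon_def by auto

lemma bigon_subset_closed_bigon: "bigon m j \<subseteq> closed_bigon m j"
  unfolding bigon_def closed_bigon_def by (intro image_mono Sigma_mono) auto

lemma wobble_nonzero:
  assumes "real j < r" "r < real j + 1" "j \<noteq> m"
  shows "wobble m r \<noteq> 0"
proof
  assume "wobble m r = 0"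
  then consider "r \<in> \<int>" | "real m \<le> r" "r \<le> real m + 1" unfolding wobble_eq_0_iff by blast
  then show False
  proof cases
    case 1
    then obtain k :: int where "r = k" by (metis Ints_cases)
    then have "int j < k" "k < int j + 1" using assms by linarith+
    then show False by linarith
  next
    case 2
    then have "real m < real (j + 1)" "real j < real (m + 1)" using assms by simp_all
    then show False using assms(3) unfolding of_nat_less_iff by linarith
  qed
qed

lemma outside_middle:
  assumes "j \<noteq> m" "real j \<le> r" "r \<le> real j + 1"
  shows "r \<le> real m \<or> real m + 1 \<le> r"
proof -
  have "real (Suc j) \<le> real m \<or> real (Suc m) \<le> real j" using assms(1) unfolding of_nat_le_iff by linarith
  then show ?thesis using assms by auto
qed

text \<open>The boundary of the parameter rectangle goes to the graph: \<open>t = 0\<close> to the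
  ray, \<open>t = 1\<close> to the arc, and each side of integral radius to a single crossing,
  because \<open>wobble\<close> vanishes there.\<close>

lemma closed_bigon_subset:
  assumes j: "0 < j" "j < n" "j \<noteq> m"
  shows "closed_bigon m j \<subseteq> bigon m j \<union> spiral_graph n m"
proof
  fix z assume "z \<in> closed_bigon m j"
  then obtain r t where z: "z = rcis r (t * wobble m r)" "real j \<le> r" "r \<le> real j + 1" "0 \<le> t" "t \<le> 1"
    unfolding closed_bigon_def by auto
  have r: "1 \<le> r" "r \<le> n" using j z by linarith+
  have rm: "r \<le> m \<or> real m + 1 \<le> r" using outside_middle[OF j(3)] z by blast
  consider "wobble m r = 0 \<or> t = 0" | "t = 1" | "r = j \<or> r = real j + 1" | "0 < t" "t < 1" "real j < r" "r < real j + 1"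
    using z by linarith
  then show "z \<in> bigon m j \<union> spiral_graph n m"
  proof cases
    case 1
    then have "z = rcis r 0" using z(1) by auto
    then show ?thesis using rcis_in_spiral_graph_iff[of n r 0 m] r j by simp
  next
    case 2
    then show ?thesis using rcis_in_spiral_graph_iff[of n r "wobble m r" m] r j z rm by (simp add: cis_angle)
  next
    case 3
    then have "r = real j \<or> r = real (Suc j)" by auto
    then have "r \<in> \<int>" using Ints_of_nat by metis
    then have "z = rcis r 0" using wobble_eq_0_iff[of m r] z(1) by simp
    then show ?thesis using rcis_in_spiral_graph_iff[of n r 0 m] r j by simp
  next
    case 4
    then show ?thesis using z(1) unfolding bigon_def by (auto intro!: image_eqI[of _ _ "(r, t)"])
  qed
qed

lemma bigon_Int_spiral_graph:
  assumes "j < n" "j \<noteq> m"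
  shows "bigon m j \<inter> spiral_graph n m = {}"
proof -
  have "rcis r (t * wobble m r) \<notin> spiral_graph n m" if r: "real j < r" "r < real j + 1" and t: "0 < t" "t < 1" for r t
  proof
    assume "rcis r (t * wobble m r) \<in> spiral_graph n m"
    moreover have "0 < r" "0 < n" using r assms by auto
    moreover have "cis (angle m r) = cis (wobble m r)" using cis_angle outside_middle[OF assms(2), of r] r by simp
    ultimately have "cis (t * wobble m r) = cis 0 \<or> cis (t * wobble m r) = cis (wobble m r)"
      using rcis_in_spiral_graph_iff[of n r "t * wobble m r" m] by auto
    then have "rcis r (t * wobble m r) = rcis r 0 \<or> rcis r (t * wobble m r) = rcis r (wobble m r)"
      by (auto simp: rcis_def)
    moreover have "\<bar>t * wobble m r - 0\<bar> < 2 * pi" "\<bar>t * wobble m r - wobble m r\<bar> < 2 * pi"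
      using abs_times_wobble_le[of t m r] abs_wobble_le[of m r] t pi_gt3 by auto
    ultimately have "t * wobble m r = 0 \<or> t * wobble m r = wobble m r"
      using rcis_eq_imp \<open>0 < r\<close> by blast
    then show False using wobble_nonzero[OF r assms(2)] t by simp
  qed
  then show ?thesis unfolding bigon_def by auto
qed

text \<open>This prepares openness: the image is described by strict inequalities between functions
  continuous off the nonpositive reals. The sign condition picks the side of the ray on which the
  excursion lies.\<close>

lemma bigon_eq:
  assumes "j \<noteq> m"
  shows "bigon m j = {z. j < cmod z \<and> cmod z < real j + 1} \<inter>
     {z \<in> - \<real>\<^sub>\<le>\<^sub>0. 0 < Arg z * wobble m (cmod z)} \<inter> {z \<in> - \<real>\<^sub>\<le>\<^sub>0. \<bar>Arg z\<bar> < \<bar>wobble m (cmod z)\<bar>}"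
    (is "_ = ?B")
proof (intro equalityI subsetI)
  fix z assume "z \<in> bigon m j"
  then obtain r t where z: "z = rcis r (t * wobble m r)" "real j < r" "r < real j + 1" "0 < t" "t < 1"
    unfolding bigon_def by auto
  have w: "wobble m r \<noteq> 0" by (rule wobble_nonzero[OF z(2,3) assms])
  have r: "0 < r" using z by linarith
  have "\<bar>t * wobble m r\<bar> \<le> 1" using abs_times_wobble_le z by simp
  then have "t * wobble m r \<in> {- pi<..pi}" using pi_gt3 by auto
  then have Arg: "Arg z = t * wobble m r"
    using r z(1) by (simp add: rcis_def Arg_cis)
  moreover have "0 < cos (t * wobble m r)"
    using \<open>\<bar>t * wobble m r\<bar> \<le> 1\<close> pi_gt3 by (intro cos_gt_zero_pi) auto
  then have "0 < Re z" using r z(1) by simp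
  then have "z \<notin> \<real>\<^sub>\<le>\<^sub>0" by (simp add: complex_nonpos_Reals_iff)
  moreover have "0 < t * wobble m r * wobble m r"
    unfolding mult.assoc power2_eq_square[symmetric] using w z by simp
  moreover have "\<bar>t * wobble m r\<bar> < \<bar>wobble m r\<bar>" using w z by (simp add: abs_mult)
  ultimately show "z \<in> ?B" using z r by simp
next
  fix z assume z: "z \<in> ?B"
  define w where "w = wobble m (cmod z)"
  have w: "w \<noteq> 0" "0 < Arg z * w" "\<bar>Arg z\<bar> < \<bar>w\<bar>" using z by (auto simp: w_def)
  have "0 < Arg z / w" using w by (auto simp: zero_less_mult_iff zero_less_divide_iff)
  moreover have "Arg z / w < 1" using w by (auto simp: divide_less_eq zero_less_mult_iff)
  moreover have "z = rcis (cmod z) (Arg z / w * wobble m (cmod z))"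
    using w rcis_cmod_Arg[of z] by (simp add: w_def)
  ultimately show "z \<in> bigon m j"
    using z unfolding bigon_def by (auto intro!: image_eqI[of _ _ "(cmod z, Arg z / w)"])
qed

lemma open_bigon:
  assumes "j \<noteq> m"
  shows "open (bigon m j)"
proof -
  have *: "open {z \<in> - \<real>\<^sub>\<le>\<^sub>0. 0 < f z}" if "continuous_on (- \<real>\<^sub>\<le>\<^sub>0) f" for f :: "complex \<Rightarrow> real"
  proof -
    have "open (- \<real>\<^sub>\<le>\<^sub>0 \<inter> f -` {0<..})"
      by (intro continuous_open_preimage that open_greaterThan open_Compl closed_nonpos_Reals_complex)
    moreover have "- \<real>\<^sub>\<le>\<^sub>0 \<inter> f -` {0<..} = {z \<in> - \<real>\<^sub>\<le>\<^sub>0. 0 < f z}" by auto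
    ultimately show ?thesis by simp
  qed
  have "open {z \<in> - \<real>\<^sub>\<le>\<^sub>0. 0 < Arg z * wobble m (cmod z)}"
    by (intro * continuous_intros continuous_on_Arg)
  moreover have "open {z \<in> - \<real>\<^sub>\<le>\<^sub>0. 0 < \<bar>wobble m (cmod z)\<bar> - \<bar>Arg z\<bar>}"
    by (intro * continuous_intros continuous_on_Arg)
  moreover have "open {z. real j < cmod z \<and> cmod z < real j + 1}"
    by (intro open_Collect_conj open_Collect_less continuous_intros)
  ultimately show ?thesis unfolding bigon_eq[OF assms] by (simp add: open_Int)
qed

text \<open>The bound 2 leaves room on either side of an excursion of height at most 1, while angle
  differences stay at most 3, below 2\<pi>, so that equal points have equal angles.\<close>

lemma rcis_in_inner_outer_region:
  assumes r: "0 < r" "r < real m \<or> real m + 1 < r" and a: "\<bar>a\<bar> \<le> 2" "\<And>t. t \<in> {0..1} \<Longrightarrow> a \<noteq> t * wobble m r" and n: "0 < n"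
  shows "rcis r a \<in> (if r < real m then inner_region n m else outer_region n m)"
proof -
  have ne: "cis a \<noteq> cis (t * wobble m r)" if "t \<in> {0..1}" for t
  proof
    assume "cis a = cis (t * wobble m r)"
    then have "rcis r a = rcis r (t * wobble m r)" by (simp add: rcis_def)
    moreover have "\<bar>a - t * wobble m r\<bar> < 2 * pi" using a(1) abs_times_wobble_le[OF that, of m r] pi_gt3 by linarith
    ultimately show False using rcis_eq_imp r a(2)[OF that] by blast
  qed
  have "cis (angle m r) = cis (wobble m r)" using r by (intro cis_angle) auto
  then have "rcis r a \<notin> spiral_graph n m"
    using ne[of 0] ne[of 1] rcis_in_spiral_graph_iff[OF n r(1)] by auto
  moreover have "rcis r a \<notin> closed_bigon m j" for j
    using ne r by (fastforce simp: closed_bigon_def rcis_eq_iff_cis)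
  moreover have "rcis r a \<notin> outer_disc m" if "r < real m"
    using norm_outer_disc[of "rcis r a" m] r that by auto
  moreover have "rcis r a \<notin> inner_disc m" if "\<not> r < real m"
    using norm_inner_disc[of "rcis r a" m] r that by auto
  ultimately show ?thesis unfolding inner_region_def outer_region_def by auto
qed

lemma rcis_in_inner_outer_region_middle:
  assumes r: "0 < r" "real m < r" "r < real m + 1" and a: "0 < a" "a < 2 * pi" "a \<noteq> 2 * pi * (r - m)" and n: "0 < n"
  shows "rcis r a \<in> (if a < 2 * pi * (r - m) then outer_region n m else inner_region n m)"
proof -
  have rm: "2 * pi * (r - m) < 2 * pi" "0 < 2 * pi * (r - m)" using r by simp_all
  have ne: "cis a \<noteq> cis b" if "0 \<le> b" "b \<le> 2 * pi" "b \<noteq> a" for b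
  proof
    assume "cis a = cis b"
    then have "rcis r a = rcis r b" by (simp add: rcis_def)
    moreover have "\<bar>a - b\<bar> < 2 * pi" using a that by auto
    ultimately show False using rcis_eq_imp r that(3) by blast
  qed
  have "rcis r a \<notin> spiral_graph n m"
    using ne[of 0] ne[of "2 * pi * (r - m)"] a r rm rcis_in_spiral_graph_iff[OF n r(1)] by (auto simp: angle_cases)
  moreover have "rcis r a \<notin> closed_bigon m j" if "j \<noteq> m" for j
    using norm_closed_bigon[of "rcis r a" m j] outside_middle[OF that, of r] r by auto
  moreover have "rcis r a \<notin> inner_disc m" if "a < 2 * pi * (r - m)"
    using ne that r by (fastforce simp: inner_disc_def rcis_eq_iff_cis)
  moreover have "rcis r a \<notin> outer_disc m" if "\<not> a < 2 * pi * (r - m)"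
    using ne that r a(3) by (fastforce simp: outer_disc_def rcis_eq_iff_cis)
  ultimately show ?thesis unfolding inner_region_def outer_region_def by auto
qed

section \<open>Its edges and orders\<close>

text \<open>In the first and last annulus, the arc edge only reaches up to the radius of an anchor.\<close>

definition edge :: "nat \<Rightarrow> nat \<Rightarrow> nat \<times> bool \<Rightarrow> complex set" where
  "edge n m = (\<lambda>(j, on_ray). if on_ray then of_real ` {j<..<real j + 1}
     else spiral m ` {max j (1/2)<..<min (real j + 1) (n + 1/2)})"

lemma norm_edge: "z \<in> edge n m (j, b) \<Longrightarrow> real j < cmod z \<and> cmod z < real j + 1"
  by (auto simp: edge_def norm_spiral split: if_splits)

lemma edge_witness:
  assumes "z \<in> edge n m (j, b)"
  obtains r where "0 < r" "real j < r" "r < real j + 1" "z = rcis r (if b then 0 else angle m r)"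
proof (cases b)
  case True
  then obtain r where "z = of_real r" "real j < r" "r < real j + 1" using assms by (auto simp: edge_def)
  then show thesis using True that[of r] by simp
next
  case False
  then obtain r where "z = spiral m r" "real j < r" "r < real j + 1" "1/2 < r" using assms by (auto simp: edge_def)
  then show thesis using False that[of r] by (simp add: spiral_def)
qed

lemma not_Ints_between:
  assumes "real j < r" "r < real j + 1"
  shows "r \<notin> \<int>"
proof
  assume "r \<in> \<int>"
  then obtain k :: int where "r = k" by (metis Ints_cases)
  then have "int j < k" "k < int j + 1" using assms by linarith+
  then show False by linarith
qed

lemma edge_nonempty:
  assumes "j \<le> n" "0 < n"
  shows "edge n m (j, b) \<noteq> {}"
proof -
  have "max (real j) (1/2) < min (real j + 1) (n + 1/2)" using assms by (cases "j = 0") auto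
  then show ?thesis by (auto simp: edge_def)
qed

lemma connected_edge: "connected (edge n m p)"
  by (auto simp: edge_def case_prod_unfold intro!: connected_continuous_image continuous_on_spiral continuous_intros)

lemma edge_in_ray_iff:
  assumes "z \<in> edge n m (j, b)"
  shows "z \<in> ray \<longleftrightarrow> b"
proof -
  obtain r where r: "0 < r" "real j < r" "r < real j + 1" "z = rcis r (if b then 0 else angle m r)"
    using edge_witness[OF assms] by blast
  show ?thesis
  proof (cases b)
    case True
    then show ?thesis using r by (simp add: ray_def)
  next
    case False
    then have "z = spiral m r" using r by (simp add: spiral_def)
    then show ?thesis using False spiral_in_ray_iff[OF r(1), of m] not_Ints_between[OF r(2,3)] by simp
  qed
qed

text \<open>The modulus of a point determines the annulus, and its membership in the ray determines
  the flag.\<close>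

lemma edge_eqD:
  assumes "z \<in> edge n m p" "z \<in> edge n m q"
  shows "p = q"
proof -
  obtain i b j c where pq: "p = (i, b)" "q = (j, c)" by (metis surj_pair)
  have "real i < real (Suc j)" "real j < real (Suc i)"
    using norm_edge[of z n m i b] norm_edge[of z n m j c] assms unfolding pq by simp_all
  then have "i = j" unfolding of_nat_less_iff by linarith
  then show ?thesis using edge_in_ray_iff assms unfolding pq by blast
qed

lemma inj_on_edge:
  assumes "0 < n"
  shows "inj_on (edge n m) ({..n} \<times> UNIV)"
proof (rule inj_onI)
  fix p q assume pq: "p \<in> {..n} \<times> UNIV" "q \<in> {..n} \<times> (UNIV :: bool set)" "edge n m p = edge n m q"
  then obtain z where "z \<in> edge n m p" using edge_nonempty[OF _ assms, of "fst p" m "snd p"] by auto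
  then show "p = q" using edge_eqD pq(3) by metis
qed

lemma between_integers:
  fixes r :: real
  assumes "0 \<le> r" "r \<notin> \<int>"
  obtains j :: nat where "real j < r" "r < real j + 1"
proof -
  have "real (nat \<lfloor>r\<rfloor>) = \<lfloor>r\<rfloor>" using assms by simp
  moreover have "real_of_int \<lfloor>r\<rfloor> \<noteq> r" using assms(2) by (metis Ints_of_int)
  then have "real_of_int \<lfloor>r\<rfloor> < r" "r < \<lfloor>r\<rfloor> + 1" by linarith+
  ultimately show thesis using that[of "nat \<lfloor>r\<rfloor>"] by simp
qed

text \<open>Removing crossings and anchors from the graph removes its points of integral modulus
  together with the two ends of the arc.\<close>

lemma Union_edge:
  assumes n: "0 < n"
  shows "\<Union>(edge n m ` ({..n} \<times> UNIV)) =
    spiral_graph n m - (crossings (meander n m) \<union> anchors (meander n m) (real n + 1))"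
    (is "?U = _ - (?C \<union> ?A)")
proof -
  have C: "?C = of_nat ` {1..n}" by (rule crossings_meander[OF n])
  have A: "?A = {0, of_real (real n + 1), spiral m (1/2), spiral m (n + 1/2)}"
    by (simp add: anchors_def pathstart_def pathfinish_def meander_def add.commute)
  have nat: "\<exists>k\<in>{1..n}. r = real k" if "r \<in> \<int>" "0 < r" "r < real n + 1" for r
  proof -
    obtain k :: int where k: "r = k" using \<open>r \<in> \<int>\<close> by (metis Ints_cases)
    then have "0 < k" "k < int n + 1" using that by linarith+
    then have "nat k \<in> {1..n}" "r = real (nat k)" using k by auto
    then show ?thesis by blast
  qed
  show ?thesis
  proof (intro equalityI subsetI)
    fix z assume "z \<in> ?U"
    then obtain j b where j: "j \<le> n" "z \<in> edge n m (j, b)" by auto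
    have no: "cmod z \<notin> \<int>" using not_Ints_between norm_edge[OF j(2)] by blast
    have G: "z \<in> spiral_graph n m"
    proof (cases b)
      case True
      then obtain r where "z = of_real r" "real j < r" "r < real j + 1" using j by (auto simp: edge_def)
      then show ?thesis using j(1) unfolding spiral_graph_eq[OF n] by auto
    next
      case False
      then obtain r where "z = spiral m r" "1/2 < r" "r < n + 1/2" using j by (auto simp: edge_def)
      then show ?thesis unfolding spiral_graph_eq[OF n] by auto
    qed
    have "z \<notin> ?C" using no unfolding C by auto
    moreover have "z \<noteq> 0" "z \<noteq> of_real (real n + 1)"
      using no by (auto simp del: of_real_add)
    moreover have "z \<noteq> spiral m (1/2) \<and> z \<noteq> spiral m (n + 1/2)"
    proof (cases b)
      case True
      then have "z \<in> ray" using edge_in_ray_iff[OF j(2)] by simp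
      then show ?thesis
        using spiral_in_ray_iff[of "1/2" m] spiral_in_ray_iff[of "n + 1/2" m] half_notin_Ints[of 0] half_notin_Ints[of n]
        by auto
    next
      case False
      then obtain r where r: "z = spiral m r" "1/2 < r" "r < n + 1/2" using j by (auto simp: edge_def)
      then have "cmod z \<noteq> cmod (spiral m (1/2))" "cmod z \<noteq> cmod (spiral m (n + 1/2))"
        using norm_spiral[of m r] norm_spiral[of m "1/2"] norm_spiral[of m "n + 1/2"] by simp_all
      then show ?thesis by metis
    qed
    ultimately show "z \<in> spiral_graph n m - (?C \<union> ?A)" using G unfolding A by blast
  next
    fix z assume z: "z \<in> spiral_graph n m - (?C \<union> ?A)"
    then consider r where "z = of_real r" "0 \<le> r" "r \<le> real n + 1" | r where "z = spiral m r" "1/2 \<le> r" "r \<le> n + 1/2"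
      unfolding spiral_graph_eq[OF n] by auto
    then show "z \<in> ?U"
    proof cases
      case (1 r)
      then have r: "0 < r" "r < real n + 1" using z unfolding A by (auto simp: less_le)
      have "r \<notin> \<int>"
      proof
        assume "r \<in> \<int>"
        then obtain k where "k \<in> {1..n}" "r = real k" using nat r by blast
        then have "z \<in> ?C" using 1 unfolding C by auto
        then show False using z by blast
      qed
      then obtain j where j: "real j < r" "r < real j + 1" using between_integers r by (metis less_imp_le)
      then have "real j < real (Suc n)" using r by simp
      then have "j \<le> n" unfolding of_nat_less_iff by simp
      moreover have "z \<in> edge n m (j, True)" using 1 j by (auto simp: edge_def)
      ultimately show ?thesis by blast
    next
      case (2 r)
      have "spiral m r \<noteq> spiral m (1/2)" "spiral m r \<noteq> spiral m (n + 1/2)" using z 2 unfolding A by blast+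
      then have ne: "r \<noteq> 1/2" "r \<noteq> n + 1/2" by metis+
      have "r \<notin> \<int>"
      proof
        assume "r \<in> \<int>"
        then obtain k where "k \<in> {1..n}" "r = real k" using nat[of r] 2 by force
        then have "z \<in> ?C" using 2 unfolding C by (auto simp: spiral_of_nat)
        then show False using z by blast
      qed
      then obtain j where j: "real j < r" "r < real j + 1" using between_integers[of r] 2 by auto
      then have "real j < real (Suc n)" using 2 by simp
      then have "j \<le> n" unfolding of_nat_less_iff by simp
      moreover have "z \<in> edge n m (j, False)" using 2 j ne by (auto simp: edge_def)
      ultimately show ?thesis by blast
    qed
  qed
qed

lemma edges_meander:
  assumes n: "0 < n"
  shows "edges (meander n m) (real n + 1) = edge n m ` ({..n} \<times> UNIV)"
proof -
  let ?S = "spiral_graph n m - (crossings (meander n m) \<union> anchors (meander n m) (real n + 1))"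
  let ?D = "edge n m ` ({..n} \<times> UNIV)"
  have "components ?S = ?D"
  proof (rule components_eq_open_partition)
    show "pairwise disjnt ?D"
      unfolding pairwise_def disjnt_def using edge_eqD by blast
    show U: "\<Union>?D = ?S" by (rule Union_edge[OF n])
    fix X assume "X \<in> ?D"
    then obtain j b where X: "X = edge n m (j, b)" "j \<le> n" by auto
    show "connected X \<and> X \<noteq> {}" unfolding X(1) using connected_edge edge_nonempty[OF X(2) n] by blast
    let ?R = "of_real ` {0..real n + 1} :: complex set" and ?P = "spiral m ` {1/2..n + 1/2}"
    \<comment> \<open>The open annulus, with the closed curve not carrying the edge taken away,
      isolates this edge from all others.\<close>
    define T where "T = {z. real j < cmod z} \<inter> {z. cmod z < real j + 1} \<inter> - (if b then ?P else ?R)"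
    have "open T"
      unfolding T_def
      by (intro open_Int open_Collect_less continuous_intros open_Compl compact_imp_closed)
        (auto intro!: compact_continuous_image continuous_on_spiral continuous_intros)
    moreover have "X = ?S \<inter> T"
    proof (intro equalityI subsetI)
      fix z assume z: "z \<in> X"
      have "z \<in> ?S" using z X U by blast
      moreover have "z \<notin> (if b then ?P else ?R)"
      proof (cases b)
        case True
        have "z \<notin> ?P"
        proof
          assume "z \<in> ?P"
          then obtain r where r: "z = spiral m r" "1/2 \<le> r" by auto
          have "z \<in> ray" using edge_in_ray_iff z X True by blast
          then have "r \<in> \<int>" using r spiral_in_ray_iff[of r m] by simp
          moreover have "real j < r" "r < real j + 1" using norm_edge[of z n m j b] z X r norm_spiral[of m r] by auto
          ultimately show False using not_Ints_between by blast
        qed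
        then show ?thesis using True by simp
      next
        case False
        then have "z \<notin> ray" using edge_in_ray_iff z X by blast
        moreover have "?R \<subseteq> ray" by (auto simp: ray_def)
        ultimately show ?thesis using False by auto
      qed
      ultimately show "z \<in> ?S \<inter> T" using norm_edge z X unfolding T_def by blast
    next
      fix z assume z: "z \<in> ?S \<inter> T"
      then obtain i c where i: "z \<in> edge n m (i, c)" "i \<le> n" using U by fastforce
      have "real i < real (Suc j)" "real j < real (Suc i)"
        using norm_edge[OF i(1)] z unfolding T_def by auto
      then have ij: "i = j" unfolding of_nat_less_iff by linarith
      have "c = b"
      proof (cases c)
        case True
        then have "z \<in> ?R" using i by (auto simp: edge_def)
        then show ?thesis using z True unfolding T_def by (auto split: if_splits)
      next
        case False
        then have "z \<in> ?P" using i by (auto simp: edge_def)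
        then show ?thesis using z False unfolding T_def by (auto split: if_splits)
      qed
      then show "z \<in> X" using i ij X by simp
    qed
    ultimately show "openin (top_of_set ?S) X" by (auto simp: openin_open)
  qed
  then show ?thesis unfolding edges_def spiral_graph_def by simp
qed

section \<open>Edges in the closures of the regions\<close>

text \<open>Edges are approached along circles about the origin: only the angle moves, from
  \<open>a\<close> in the direction given by the sign of \<open>b\<close>.\<close>

lemma rcis_in_closure:
  assumes "\<And>t. 0 < t \<Longrightarrow> t < 1 \<Longrightarrow> rcis r (a + t * b) \<in> R"
  shows "rcis r a \<in> closure R"
proof -
  have "((\<lambda>t. rcis r (a + t * b)) \<longlongrightarrow> rcis r (a + 0 * b)) (at_right 0)"
    unfolding rcis_def by (intro tendsto_intros continuous_on_cis)
  moreover have "\<forall>\<^sub>F t in at_right 0. rcis r (a + t * b) \<in> closure R"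
    using eventually_at_right_real[of 0 1] assms closure_subset by (auto elim!: eventually_mono)
  ultimately have "rcis r (a + 0 * b) \<in> closure R"
    by (rule Lim_in_closed_set[rotated 3, OF _ closed_closure]) auto
  then show ?thesis by simp
qed

lemma edge_subset_closure_outside:
  assumes "j \<noteq> m" "0 < n"
  shows "edge n m (j, b) \<subseteq> closure (if j < m then inner_region n m else outer_region n m)"
proof
  fix z assume "z \<in> edge n m (j, b)"
  then obtain r where r: "0 < r" "real j < r" "r < real j + 1" "z = rcis r (if b then 0 else angle m r)"
    by (rule edge_witness)
  have rm: "r < real m \<or> real m + 1 < r" "j < m \<longleftrightarrow> r < real m"
  proof -
    have "real (Suc j) \<le> real m \<or> real (Suc m) \<le> real j" using assms(1) unfolding of_nat_le_iff by linarith
    then show "r < real m \<or> real m + 1 < r" "j < m \<longleftrightarrow> r < real m" using r by auto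
  qed
  define w where "w = wobble m r"
  have w: "w \<noteq> 0" "\<bar>w\<bar> \<le> 1" using wobble_nonzero[OF r(2,3) assms(1)] abs_wobble_le by (auto simp: w_def)
  let ?R = "if r < real m then inner_region n m else outer_region n m"
  have "rcis r (if b then 0 else w) \<in> closure ?R"
  \<comment> \<open>The ray is approached from the side opposite to the excursion, the arc from
    beyond the excursion.\<close>
  proof (rule rcis_in_closure[where b = "if b then - w else w"])
    fix t :: real assume t: "0 < t" "t < 1"
    define u where "u = (if b then - t else 1 + t)"
    have eq: "(if b then 0 else w) + t * (if b then - w else w) = u * w"
      by (simp add: u_def algebra_simps)
    have "\<bar>u * w\<bar> \<le> 2 * 1" unfolding abs_mult using t w by (intro mult_mono) (auto simp: u_def)
    moreover have "u * w \<noteq> s * wobble m r" if "s \<in> {0..1}" for s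
      using that w(1) t by (auto simp: u_def w_def[symmetric])
    ultimately show "rcis r ((if b then 0 else w) + t * (if b then - w else w)) \<in> ?R"
      unfolding eq using rcis_in_inner_outer_region[OF r(1) rm(1) _ _ assms(2)] by simp
  qed
  moreover have "rcis r (if b then 0 else w) = z"
    using rm(1) cis_angle[of r m] unfolding r(4) w_def rcis_def by auto
  ultimately show "z \<in> closure (if j < m then inner_region n m else outer_region n m)" using rm(2) by simp
qed

lemma edge_subset_closure_middle:
  assumes "0 < n"
  shows "edge n m (m, b) \<subseteq> closure (inner_region n m)" "edge n m (m, b) \<subseteq> closure (outer_region n m)"
proof -
  have "z \<in> closure (inner_region n m) \<and> z \<in> closure (outer_region n m)" if z: "z \<in> edge n m (m, b)" for z
  proof -
    obtain r where r: "0 < r" "real m < r" "r < real m + 1" "z = rcis r (if b then 0 else angle m r)"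
      using z by (rule edge_witness)
    define \<theta> where "\<theta> = 2 * pi * (r - m)"
    have \<theta>: "0 < \<theta>" "\<theta> < 2 * pi" using r by (simp_all add: \<theta>_def)
    have z1: "z = rcis r (if b then 0 else \<theta>)" using r by (simp add: angle_cases \<theta>_def)
    \<comment> \<open>On the ray, the inner region is reached through angles just below 2\<pi> and
      the outer one through angles just above 0, so both names of the point are used.\<close>
    have z2: "z = rcis r (if b then 2 * pi else \<theta>)" using z1 by (simp add: rcis_def)
    have inner: "rcis r a \<in> inner_region n m" if "\<theta> < a" "a < 2 * pi" for a
      using rcis_in_inner_outer_region_middle[OF r(1-3), of a n] that \<theta> assms by (simp add: \<theta>_def)
    have outer: "rcis r a \<in> outer_region n m" if "0 < a" "a < \<theta>" for a
      using rcis_in_inner_outer_region_middle[OF r(1-3), of a n] that \<theta> assms by (simp add: \<theta>_def)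
    have conv: "x < x + t * (y - x) \<and> x + t * (y - x) < y" if "x < y" "0 < t" "t < 1" for x y t :: real
      proof -
      have "t * (y - x) < 1 * (y - x)" using that by (intro mult_strict_right_mono) simp_all
      then have "x + t * (y - x) < x + (y - x)" by simp
      then show ?thesis using that by simp
    qed
    have conv': "y < x + t * (y - x) \<and> x + t * (y - x) < x" if "y < x" "0 < t" "t < 1" for x y t :: real
      using conv[of "- x" "- y" t] that by (simp add: algebra_simps)
    have "rcis r (if b then 2 * pi else \<theta>) \<in> closure (inner_region n m)"
      using \<theta> conv[of \<theta> "2 * pi"] conv'[of \<theta> "2 * pi"]
      by (intro rcis_in_closure[where b = "if b then \<theta> - 2 * pi else 2 * pi - \<theta>"] inner) auto
    moreover have "rcis r (if b then 0 else \<theta>) \<in> closure (outer_region n m)"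
      using \<theta> conv[of 0 \<theta>] conv'[of 0 \<theta>]
      by (intro rcis_in_closure[where b = "if b then \<theta> else - \<theta>"] outer) auto
    ultimately show ?thesis using z1 z2 by simp
  qed
  then show "edge n m (m, b) \<subseteq> closure (inner_region n m)" "edge n m (m, b) \<subseteq> closure (outer_region n m)"
    by blast+
qed

lemma edge_subset_closure_bigon:
  assumes "j \<noteq> m"
  shows "edge n m (j, b) \<subseteq> closure (bigon m j)"
proof
  fix z assume "z \<in> edge n m (j, b)"
  then obtain r where r: "0 < r" "real j < r" "r < real j + 1" "z = rcis r (if b then 0 else angle m r)"
    by (rule edge_witness)
  have "rcis r (if b then 0 else wobble m r) \<in> closure (bigon m j)"
  proof (rule rcis_in_closure[where b = "if b then wobble m r else - wobble m r"])
    fix t :: real assume t: "0 < t" "t < 1"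
    have "(if b then 0 else wobble m r) + t * (if b then wobble m r else - wobble m r) = (if b then t else 1 - t) * wobble m r"
      by (simp add: algebra_simps)
    then show "rcis r ((if b then 0 else wobble m r) + t * (if b then wobble m r else - wobble m r)) \<in> bigon m j"
      using r t unfolding bigon_def by (auto intro!: image_eqI[of _ _ "(r, if b then t else 1 - t)"])
  qed
  moreover have "rcis r (if b then 0 else wobble m r) = z"
    using cis_angle[of r m] outside_middle[OF assms, of r] r(2,3) unfolding r(4) rcis_def by auto
  ultimately show "z \<in> closure (bigon m j)" by simp
qed


section \<open>The sides of the regions\<close>

lemma regions_subset_Compl:
  "inner_region n m \<subseteq> - spiral_graph n m" "outer_region n m \<subseteq> - spiral_graph n m"
  unfolding inner_region_def outer_region_def by auto

lemma norm_inner_outer_region: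
  "z \<in> inner_region n m \<Longrightarrow> cmod z \<le> real m + 1" "z \<in> outer_region n m \<Longrightarrow> real m \<le> cmod z"
proof -
  show "cmod z \<le> real m + 1" if "z \<in> inner_region n m"
    using that norm_inner_disc[of z m] inner_Un_outer_disc[of m] unfolding inner_region_def by blast
  show "real m \<le> cmod z" if "z \<in> outer_region n m"
    using that norm_outer_disc[of z m] inner_Un_outer_disc[of m] unfolding outer_region_def by blast
qed

lemma edge_subset_spiral_graph:
  assumes "0 < n" "j \<le> n"
  shows "edge n m (j, b) \<subseteq> spiral_graph n m"
  using Union_edge[OF assms(1), of m] assms(2) by blast

text \<open>Weak bounds on the modulus pass to the closure, whereas an edge stays strictly inside
  its annulus; this excludes the edges of annuli that the region does not reach.\<close>

lemma edge_subset_closureD: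
  assumes "0 < n" "j \<le> n" and sub: "edge n m (j, b) \<subseteq> closure R" and R: "R \<subseteq> {z. u \<le> cmod z \<and> cmod z \<le> v}"
  shows "u < real j + 1" "real j < v"
proof -
  obtain z where z: "z \<in> edge n m (j, b)" using edge_nonempty[OF assms(2,1)] by blast
  have "{z. u \<le> cmod z \<and> cmod z \<le> v} = {z. u \<le> cmod z} \<inter> {z. cmod z \<le> v}" by auto
  then have "closed {z :: complex. u \<le> cmod z \<and> cmod z \<le> v}"
    by (simp add: closed_Int closed_Collect_le continuous_intros)
  then have "closure R \<subseteq> {z. u \<le> cmod z \<and> cmod z \<le> v}" using R by (rule closure_minimal[rotated])
  then have "u \<le> cmod z" "cmod z \<le> v" using z sub by auto
  then show "u < real j + 1" "real j < v" using norm_edge[OF z] by auto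
qed

text \<open>Every annulus carries two edges, one on the ray and one on the arc. Edges lie in the
  graph and so miss the open set \<open>R\<close>, which lets the closure stand in for the
  frontier.\<close>

lemma num_sides_eq:
  assumes n: "0 < n" and N: "N \<subseteq> {..n}" and R: "open R" "R \<subseteq> - spiral_graph n m"
    and iff: "\<And>j b. j \<le> n \<Longrightarrow> edge n m (j, b) \<subseteq> closure R \<longleftrightarrow> j \<in> N"
  shows "num_sides (meander n m) (real n + 1) R = 2 * card N"
proof -
  have fr: "e \<subseteq> frontier R \<longleftrightarrow> e \<subseteq> closure R" if "e \<in> edge n m ` ({..n} \<times> UNIV)" for e
  proof -
    have "e \<subseteq> spiral_graph n m" using edge_subset_spiral_graph[OF n] that by blast
    then have "e \<inter> R = {}" using R(2) by blast
    then show ?thesis unfolding frontier_def interior_open[OF R(1)] by blast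
  qed
  have "{e \<in> edges (meander n m) (real n + 1). e \<subseteq> frontier R} = edge n m ` (N \<times> UNIV)"
  proof (intro equalityI subsetI)
    fix e assume "e \<in> {e \<in> edges (meander n m) (real n + 1). e \<subseteq> frontier R}"
    then have e: "e \<in> edge n m ` ({..n} \<times> UNIV)" "e \<subseteq> frontier R" unfolding edges_meander[OF n] by blast+
    then obtain j b where "j \<le> n" "e = edge n m (j, b)" by blast
    then show "e \<in> edge n m ` (N \<times> UNIV)" using iff fr[OF e(1)] e(2) by blast
  next
    fix e assume "e \<in> edge n m ` (N \<times> UNIV)"
    then obtain j b where j: "j \<in> N" "e = edge n m (j, b)" by blast
    then have e: "e \<in> edge n m ` ({..n} \<times> UNIV)" using N by blast
    moreover have "e \<subseteq> closure R" using iff j N by blast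
    ultimately show "e \<in> {e \<in> edges (meander n m) (real n + 1). e \<subseteq> frontier R}"
      using fr[OF e] unfolding edges_meander[OF n] by blast
  qed
  moreover have "inj_on (edge n m) (N \<times> UNIV)"
    using inj_on_subset[OF inj_on_edge[OF n]] N by blast
  ultimately show ?thesis
    unfolding num_sides_def by (simp add: card_image card_cartesian_product mult.commute)
qed

lemma num_sides_inner_region:
  assumes m: "0 < m" "m < n"
  shows "num_sides (meander n m) (real n + 1) (inner_region n m) = 2 * (m + 1)"
proof -
  have n: "0 < n" using m by simp
  have "num_sides (meander n m) (real n + 1) (inner_region n m) = 2 * card {..m}"
  proof (rule num_sides_eq[OF n])
    fix j b assume j: "j \<le> n"
    show "edge n m (j, b) \<subseteq> closure (inner_region n m) \<longleftrightarrow> j \<in> {..m}"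
    proof
      assume sub: "edge n m (j, b) \<subseteq> closure (inner_region n m)"
      have "inner_region n m \<subseteq> {z. 0 \<le> cmod z \<and> cmod z \<le> real m + 1}"
        using norm_inner_outer_region(1) by auto
      then have "real j < real (Suc m)" using edge_subset_closureD(2)[OF n j sub] by fastforce
      then show "j \<in> {..m}" unfolding of_nat_less_iff by simp
    next
      assume "j \<in> {..m}"
      then show "edge n m (j, b) \<subseteq> closure (inner_region n m)"
        using edge_subset_closure_outside[of j m n b] edge_subset_closure_middle(1)[OF n, of m b] n
        by (cases "j = m") auto
    qed
  qed (use m open_inner_outer_region[OF n] regions_subset_Compl in auto)
  then show ?thesis by simp
qed

lemma num_sides_outer_region:
  assumes m: "0 < m" "m < n"
  shows "num_sides (meander n m) (real n + 1) (outer_region n m) = 2 * (n - m + 1)"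
proof -
  have n: "0 < n" using m by simp
  have "num_sides (meander n m) (real n + 1) (outer_region n m) = 2 * card {m..n}"
  proof (rule num_sides_eq[OF n])
    fix j b assume j: "j \<le> n"
    show "edge n m (j, b) \<subseteq> closure (outer_region n m) \<longleftrightarrow> j \<in> {m..n}"
    proof
      assume sub: "edge n m (j, b) \<subseteq> closure (outer_region n m)"
      show "j \<in> {m..n}"
      proof (rule ccontr)
        assume "j \<notin> {m..n}"
        then have jm: "j < m" using j by simp
        \<comment> \<open>The outer region is unbounded, so only the lower bound on the modulus is
          carried over to the closure.\<close>
        have "closure (outer_region n m) \<subseteq> {z. real m \<le> cmod z}"
          using norm_inner_outer_region(2) by (intro closure_minimal closed_Collect_le continuous_intros) auto
        moreover obtain z where "z \<in> edge n m (j, b)" using edge_nonempty[OF j n] by blast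
        ultimately have "real m < real (Suc j)" using norm_edge[of z n m j b] sub by fastforce
        then show False using jm unfolding of_nat_less_iff by simp
      qed
    next
      assume "j \<in> {m..n}"
      then show "edge n m (j, b) \<subseteq> closure (outer_region n m)"
        using edge_subset_closure_outside[of j m n b] edge_subset_closure_middle(2)[OF n, of m b] n
        by (cases "j = m") auto
    qed
  qed (use m open_inner_outer_region[OF n] regions_subset_Compl in auto)
  then show ?thesis using m by simp
qed

lemma num_sides_bigon:
  assumes j: "0 < j" "j < n" "j \<noteq> m"
  shows "num_sides (meander n m) (real n + 1) (bigon m j) = 2"
proof -
  have n: "0 < n" using j by simp
  have "num_sides (meander n m) (real n + 1) (bigon m j) = 2 * card {j}"
  proof (rule num_sides_eq[OF n])
    fix i b assume i: "i \<le> n"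
    show "edge n m (i, b) \<subseteq> closure (bigon m j) \<longleftrightarrow> i \<in> {j}"
    proof
      assume sub: "edge n m (i, b) \<subseteq> closure (bigon m j)"
      have "bigon m j \<subseteq> {z. real j \<le> cmod z \<and> cmod z \<le> real j + 1}" using norm_bigon by fastforce
      then have "real j < real (Suc i)" "real i < real (Suc j)"
        using edge_subset_closureD[OF n i sub, of "real j" "real j + 1"] by simp_all
      then show "i \<in> {j}" unfolding of_nat_less_iff by simp
    qed (use edge_subset_closure_bigon[OF j(3)] in simp)
  qed (use j open_bigon[OF j(3)] bigon_Int_spiral_graph[OF j(2,3)] in auto)
  then show ?thesis by simp
qed

section \<open>The complete list of regions\<close>

lemma bigon_nonempty: "bigon m j \<noteq> {}"
proof -
  have "real j + 1/2 \<in> {j<..<real j + 1}" "1/2 \<in> {0<..<1::real}" by auto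
  then show ?thesis unfolding bigon_def by blast
qed

lemma bigon_disjoint:
  assumes "z \<in> bigon m i" "z \<in> bigon m j"
  shows "i = j"
proof -
  have "real i < real (Suc j)" "real j < real (Suc i)"
    using norm_bigon[OF assms(1)] norm_bigon[OF assms(2)] by simp_all
  then show ?thesis unfolding of_nat_less_iff by linarith
qed

lemma inner_outer_region_nonempty:
  assumes "0 < n"
  shows "inner_region n m \<noteq> {}" "outer_region n m \<noteq> {}"
proof -
  have "edge n m (m, True) \<noteq> {}" by (auto simp: edge_def)
  then show "inner_region n m \<noteq> {}" "outer_region n m \<noteq> {}"
    using edge_subset_closure_middle[OF assms, of m True] by (metis closure_empty subset_empty)+
qed

lemma regions_meander:
  assumes m: "0 < m" "m < n"
  defines "J \<equiv> {1..<n} - {m}"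
  shows "regions (meander n m) (real n + 1) = insert (inner_region n m) (insert (outer_region n m) (bigon m ` J))"
    and "inner_region n m \<noteq> outer_region n m" "inner_region n m \<notin> bigon m ` J" "outer_region n m \<notin> bigon m ` J"
    and "inj_on (bigon m) J"
proof -
  let ?I = "inner_region n m" and ?O = "outer_region n m"
  let ?D = "insert ?I (insert ?O (bigon m ` J))"
  have n: "0 < n" using m by simp
  have J: "0 < j" "j < n" "j \<noteq> m" if "j \<in> J" for j using that by (auto simp: J_def)
  have IO: "?I \<inter> ?O = {}" using inner_Un_outer_disc[of m] unfolding inner_region_def outer_region_def by blast
  have B: "?I \<inter> bigon m j = {}" "?O \<inter> bigon m j = {}" if "j \<in> J" for j
    using that bigon_subset_closed_bigon[of m j] unfolding inner_region_def outer_region_def J_def by blast+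
  note ne = inner_outer_region_nonempty[OF n, of m]
  show a: "?I \<noteq> ?O" using IO ne by blast
  show b: "?I \<notin> bigon m ` J" "?O \<notin> bigon m ` J" using B ne by blast+
  show c: "inj_on (bigon m) J" using bigon_disjoint bigon_nonempty by (metis inj_onI equals0I)
  have finJ: "finite J" by (simp add: J_def)
  \<comment> \<open>The indices \<open>1\<close> to \<open>n - 1\<close> without \<open>m\<close>;
    with the inner and outer region the list has \<open>n\<close> members, exactly the largest
    number of regions that \<open>n\<close> crossings allow.\<close>
  have "card J = n - 2" using m by (simp add: J_def)
  then have card: "card ?D = n" using a b c finJ m by (simp add: card_image)
  have d: "doubly_anchored_open_semi_meander (meander n m) (real n + 1)" by (rule meander_doubly_anchored[OF n])
  have "card (crossings (meander n m)) = n"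
    unfolding crossings_meander[OF n] by (simp add: card_image inj_on_def)
  then have le: "card (regions (meander n m) (real n + 1)) \<le> card ?D"
    using card_regions_le(2)[OF d] n card by simp
  have "components (- spiral_graph n m) = ?D"
  proof (rule components_eq_card_le)
    have "X \<inter> Y = {}" if "X \<in> ?D" "Y \<in> ?D" "X \<noteq> Y" for X Y
      using that IO B bigon_disjoint by blast
    then show "pairwise disjnt ?D" unfolding pairwise_def disjnt_def by blast
    have "bigon m j \<subseteq> - spiral_graph n m" if "j \<in> J" for j
      using bigon_Int_spiral_graph[of j n m] J[OF that] by blast
    then have "\<Union>?D \<subseteq> - spiral_graph n m"
      using regions_subset_Compl[of n m] by (simp add: UN_subset_iff)
    moreover have "z \<in> \<Union>?D" if z: "z \<notin> spiral_graph n m" for z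
    proof (cases "\<exists>j\<in>J. z \<in> closed_bigon m j")
      case True
      then obtain j where "j \<in> J" "z \<in> closed_bigon m j" by blast
      then have "z \<in> bigon m j" using closed_bigon_subset[OF J] z by blast
      then show ?thesis using \<open>j \<in> J\<close> by simp blast
    next
      case False
      \<comment> \<open>The two discs overlap only within the graph, so a remaining point misses one
        of them and lies in the opposite region.\<close>
      moreover have "z \<notin> inner_disc m \<or> z \<notin> outer_disc m"
        using inner_Int_outer_disc[OF m] z by blast
      ultimately show ?thesis
        using z by (auto simp: inner_region_def outer_region_def J_def)
    qed
    ultimately show "\<Union>?D = - spiral_graph n m" by blast
    show "open X \<and> X \<noteq> {}" if "X \<in> ?D" for X
      using that open_inner_outer_region[OF n, of m] ne open_bigon J bigon_nonempty by blast
    show "finite (components (- spiral_graph n m))" "card (components (- spiral_graph n m)) \<le> card ?D"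
      using card_regions_le(1)[OF d] le unfolding regions_def spiral_graph_def by simp_all
  qed
  then show "regions (meander n m) (real n + 1) = ?D" unfolding regions_def spiral_graph_def .
qed

section \<open>Orders and conclusion\<close>

lemma region_orderI:
  assumes "int (num_sides g L R) = 2 * k + 4"
  shows "region_order g L R = k"
  unfolding region_order_def using assms by (intro the_equality) auto

text \<open>The choice of \<open>m\<close> gives the inner region
  \<open>2 * (m + 1) = 2 * k1 + 4\<close> sides and the outer region
  \<open>2 * (n - m + 1) = 2 * k2 + 4\<close>. The \<open>k1 + k2\<close> bigons and the four
  anchors supply the entries -1.\<close>

lemma orders_meander:
  fixes k1 k2 :: nat
  defines "n \<equiv> k1 + k2 + 2" and "m \<equiv> k1 + 1"
  shows "orders (meander n m) (real n + 1) = {#int k1, int k2#} + replicate_mset (k1 + k2 + 4) (- 1)"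
proof -
  let ?g = "meander n m" and ?L = "real n + 1"
  define J where "J = {1..<n} - {m}"
  have m: "0 < m" "m < n" and n: "0 < n" by (simp_all add: m_def n_def)
  note reg = regions_meander[OF m, folded J_def]
  have finJ: "finite J" and cardJ: "card J = k1 + k2" by (simp_all add: J_def m_def n_def)
  have d: "doubly_anchored_open_semi_meander ?g ?L" by (rule meander_doubly_anchored[OF n])
  have "region_order ?g ?L (inner_region n m) = int k1"
    using num_sides_inner_region[OF m] by (intro region_orderI) (simp add: m_def)
  moreover have "region_order ?g ?L (outer_region n m) = int k2"
    using num_sides_outer_region[OF m] by (intro region_orderI) (simp add: m_def n_def)
  moreover have "region_order ?g ?L R = - 1" if R: "R \<in> bigon m ` J" for R
  proof -
    obtain j where j: "R = bigon m j" "j \<in> J" using R by blast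
    then have "0 < j" "j < n" "j \<noteq> m" unfolding J_def by simp_all
    then show ?thesis unfolding j(1) using num_sides_bigon[of j n m] by (intro region_orderI) simp
  qed
  then have "image_mset (region_order ?g ?L) (mset_set (bigon m ` J)) = image_mset (\<lambda>_. - 1) (mset_set (bigon m ` J))"
    using finJ by (intro image_mset_cong) simp
  then have "image_mset (region_order ?g ?L) (mset_set (bigon m ` J)) = replicate_mset (card J) (- 1)"
    using finJ card_image[OF reg(5)] by (simp add: image_mset_const_eq)
  moreover have "mset_set (regions ?g ?L) =
      {#inner_region n m, outer_region n m#} + mset_set (bigon m ` J)"
    unfolding reg(1) using reg(2-4) finJ by simp
  moreover have "image_mset (\<lambda>v. - 1) (mset_set (anchors ?g ?L)) = replicate_mset 4 (- 1 :: int)"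
    using card_anchors[OF d] by (simp add: image_mset_const_eq)
  moreover have "replicate_mset (card J) (- 1) + replicate_mset 4 (- 1) = replicate_mset (k1 + k2 + 4) (- 1 :: int)"
    by (simp add: cardJ multiset_eq_iff)
  ultimately show ?thesis unfolding orders_def by simp
qed

theorem proposition4p6:
  fixes k1 k2 :: nat
  assumes "k2 \<le> k1"
  defines "K \<equiv> {#int k1, int k2#} + replicate_mset (k1 + k2 + 4) (- 1)"
  shows "(\<exists>g L. doubly_anchored_open_semi_meander g L \<and> in_stratum g L K \<and>
            card (crossings g) = k1 + k2 + 2) \<and>
         (\<forall>g L. doubly_anchored_open_semi_meander g L \<and> in_stratum g L K \<longrightarrow>
            k1 + k2 + 2 \<le> card (crossings g))"
proof (intro conjI allI impI exI)
  let ?n = "k1 + k2 + 2"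
  let ?g = "meander ?n (k1 + 1)" and ?L = "real ?n + 1"
  show "doubly_anchored_open_semi_meander ?g ?L" by (rule meander_doubly_anchored) simp
  \<comment> \<open>The extremal configuration has no 4-gons beyond the listed ones, so the number
    of additional zeros is 0.\<close>
  show "in_stratum ?g ?L K"
    unfolding in_stratum_def K_def using orders_meander[of k1 k2] by (intro exI[of _ 0]) simp
  show "card (crossings ?g) = k1 + k2 + 2"
    using crossings_meander[of ?n "k1 + 1"] by (simp add: card_image inj_on_def)
next
  fix g L assume "doubly_anchored_open_semi_meander g L \<and> in_stratum g L K"
  then show "k1 + k2 + 2 \<le> card (crossings g)"
    using stratum_lower_bound unfolding K_def by blast
qed

end
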